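(* For every real constant $\theta$ with $0<\theta\leq 0.06$, there exists a hybrid feedback control $\mathbb{K}=\big(Q,(C_q,D_q,\varphi_q,G_q)_{q\in Q}\big)$ such that the origin is globally asymptotically stable for the system $$ \left\{\begin{array}{rcl} \dot{x}_1&=&x_1+x_2+\theta x_1^2+\theta(1+x_1)\sin(u),\\ \dot{x}_2&=&u, \end{array}\right. $$ with state $(x_1,x_2)\in\mathbb{R}\times\mathbb{R}$ and control $u\in\mathbb{R}$, in closed loop with $\mathbb{K}$.
   Context: Write $x=(x_1,x_2)\in\mathbb{R}^2$ and write the system as $\dot{x}=f_h(x,u)$, i.e. $f_h(x,u)=\big(x_1+x_2+\theta x_1^2+\theta(1+x_1)\sin(u),\,u\big)$. **Hybrid feedback control.** A hybrid feedback control $\mathbb{K}$ for $\dot x=f_h(x,u)$ consists of: - a totally ordered set $Q$ (endowed with the discrete topology); - for each $q\in Q$: closed sets $C_q\subset\mathbb{R}^2$ and $D_q\subset\mathbb{R}^2$ with $C_q\cup D_q=\mathbb{R}^2$; a continuous function $\varphi_q:C_q\to\mathbb{R}$; and a set-valued map $G_q:D_q\rightrightarrows Q$ with non-empty images which is outer semicontinuous and locally bounded, uniformly in $Q$ (outer semicontinuous: its graph is closed in $D_q\times Q$; locally bounded, uniformly in $Q$: for each compact $K\subset\mathbb{R}^2$ the set $\bigcup_{q\in Q}G_q(K\cap D_q)$ is contained in a finite subset of $Q$; these conditions on boundedness are automatic if $Q$ is finite). **Closed loop.** The system in closed loop with $\mathbb{K}$ is the hybrid system with state $(x,q)\in\mathbb{R}^2\times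 Q$ given by $$ \left\{\begin{array}{rcll} \dot{x}&=&f_h(x,\varphi_q(x)),& x\in C_q,\\ q^+&\in&G_q(x),& x\in D_q, \end{array}\right. $$ where $q$ is constant during flows and $x$ is unchanged at jumps. Solutions are understood in the standard sense of hybrid systems: a solution $(t,j)\mapsto(x(t,j),q(t,j))$ is defined on a hybrid time domain $E\subset\mathbb{R}_{\geq0}\times\mathbb{N}$ (a union of finitely or infinitely many intervals $[t_j,t_{j+1}]\times\{j\}$ with $0=t_0\leq t_1\leq\cdots$, the last interval, if there is one, being possibly of the form $[t_j,T)\times\{j\}$ with $T\leq\infty$). On each interval with non-empty interior, $x(\cdot,j)$ is locally absolutely continuous, $q(\cdot,j)$ is constant, $x(t,j)\in C_{q(t,j)}$ for all $t$ in the interior of the interval, and $\dot x=f_h(x,\varphi_q(x))$ almost everywhere. Whenever $(t,j),(t,j+1)\in E$, one has $x(t,j)\in D_{q(t,j)}$, $x(t,j+1)=x(t,j)$ and $q(t,j+1)\in G_{q(t,j)}(x(t,j))$. A solution is maximal if it cannot be extended, and complete if its domain is unbounded. **Global asymptotic stability of the origin.** The origin is globally asymptotically stable for the closed loop if: (i) for each $\varepsilon>0$ there is $\delta>0$ such that every solution with $\|x(0,0)\|\leq\delta$ satisfies $\|x(t,j)\|\leq\varepsilon$ for all $(t,j)$ in its domain; and (ii) every maximal solution, from any initial condition $(x(0,0),q(0,0))\in\mathbb{R}^2\times Q$, is complete and satisfies $\|x(t,j)\|\to0$ as $t+j\to\infty$. *)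

theory Defs
  imports "HOL-Analysis.Analysis"
begin

section \<open>Hybrid feedback controls\<close>

text \<open>
  \<open>flow_law K q\<close> and \<open>jump_map K q\<close> are total HOL functions; only their values on
  \<open>flow_set K q\<close> and \<open>jump_set K q\<close>, respectively, are ever used.
\<close>

record ('x, 'q) hybrid_feedback =
  modes :: "'q set"
  mode_order :: "('q \<times> 'q) set"
  flow_set :: "'q \<Rightarrow> 'x set"
  jump_set :: "'q \<Rightarrow> 'x set"
  flow_law :: "'q \<Rightarrow> 'x \<Rightarrow> real"
  jump_map :: "'q \<Rightarrow> 'x \<Rightarrow> 'q set"

text \<open>
  Outer semicontinuity: the graph is closed in \<open>D \<times> Q\<close>, where \<open>Q\<close> carries the discrete topology.
\<close>

definition outer_semicontinuous_map ::
  "'x::topological_space set \<Rightarrow> 'q set \<Rightarrow> ('x \<Rightarrow> 'q set) \<Rightarrow> bool" where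
  "outer_semicontinuous_map D Q G \<longleftrightarrow>
     closedin (prod_topology (top_of_set D) (discrete_topology Q)) {(x, p). x \<in> D \<and> p \<in> G x}"

text \<open>
  The set of modes has to be non-empty: with no modes the closed loop would have no solution
  at all, and its stability would hold vacuously.
\<close>

definition is_hybrid_feedback :: "('x::euclidean_space, 'q) hybrid_feedback \<Rightarrow> bool" where
  "is_hybrid_feedback K \<longleftrightarrow>
     modes K \<noteq> {} \<and>
     linear_order_on (modes K) (mode_order K) \<and>
     (\<forall>q\<in>modes K.
        closed (flow_set K q) \<and> closed (jump_set K q) \<and>
        flow_set K q \<union> jump_set K q = UNIV \<and>
        continuous_on (flow_set K q) (flow_law K q) \<and>
        (\<forall>x\<in>jump_set K q. jump_map K q x \<noteq> {} \<and> jump_map K q x \<subseteq> modes K) \<and>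
        outer_semicontinuous_map (jump_set K q) (modes K) (jump_map K q)) \<and>
     (\<forall>A. compact A \<longrightarrow>
        (\<exists>F. finite F \<and> F \<subseteq> modes K \<and>
             (\<Union>q\<in>modes K. \<Union>x\<in>A \<inter> jump_set K q. jump_map K q x) \<subseteq> F))"

section \<open>Solutions of the closed loop\<close>

text \<open>
  In the second alternative \<open>J\<close> is the index of the last interval, which is closed, or half-open
  with a possibly infinite right end point \<open>T\<close>.
\<close>

definition hybrid_time_domain :: "(real \<times> nat) set \<Rightarrow> bool" where
  "hybrid_time_domain E \<longleftrightarrow>
     (\<exists>t::nat \<Rightarrow> real. t 0 = 0 \<and> incseq t \<and>
        (E = (\<Union>j. {t j..t (Suc j)} \<times> {j}) \<or>
         (\<exists>J I. E = (\<Union>j<J. {t j..t (Suc j)} \<times> {j}) \<union> I \<times> {J} \<and>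
            (I = {t J..t (Suc J)} \<or>
             (\<exists>T::ereal. ereal (t J) < T \<and> I = {s. t J \<le> s \<and> ereal s < T})))))"

definition time_slice :: "(real \<times> nat) set \<Rightarrow> nat \<Rightarrow> real set" where
  "time_slice E j = {t. (t, j) \<in> E}"

definition abs_continuous_on_interval ::
  "real \<Rightarrow> real \<Rightarrow> (real \<Rightarrow> 'x::real_normed_vector) \<Rightarrow> bool" where
  "abs_continuous_on_interval u v g \<longleftrightarrow>
     (\<forall>\<epsilon>>0. \<exists>\<delta>>0. \<forall>(n::nat) a b.
        (\<forall>i<n. u \<le> a i \<and> a i \<le> b i \<and> b i \<le> v) \<and>
        (\<forall>i<n. \<forall>k<n. i \<noteq> k \<longrightarrow> {a i<..<b i} \<inter> {a k<..<b k} = {}) \<and>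
        (\<Sum>i<n. b i - a i) < \<delta> \<longrightarrow>
        (\<Sum>i<n. norm (g (b i) - g (a i))) < \<epsilon>)"

definition loc_abs_continuous_on :: "real set \<Rightarrow> (real \<Rightarrow> 'x::real_normed_vector) \<Rightarrow> bool" where
  "loc_abs_continuous_on I g \<longleftrightarrow>
     (\<forall>u v. u \<le> v \<and> {u..v} \<subseteq> I \<longrightarrow> abs_continuous_on_interval u v g)"

text \<open>
  A hybrid arc is given by its domain \<open>E\<close> and functions \<open>x t j\<close> and \<open>q t j\<close>, whose values
  outside \<open>E\<close> are irrelevant. The plant is \<open>x' = f x u\<close>.
\<close>

definition closed_loop_solution ::
  "('x::euclidean_space \<Rightarrow> real \<Rightarrow> 'x) \<Rightarrow> ('x, 'q) hybrid_feedback \<Rightarrow>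
   (real \<times> nat) set \<Rightarrow> (real \<Rightarrow> nat \<Rightarrow> 'x) \<Rightarrow> (real \<Rightarrow> nat \<Rightarrow> 'q) \<Rightarrow> bool" where
  "closed_loop_solution f K E x q \<longleftrightarrow>
     hybrid_time_domain E \<and>
     (\<forall>(t, j)\<in>E. q t j \<in> modes K) \<and>
     (\<forall>j. interior (time_slice E j) \<noteq> {} \<longrightarrow>
        loc_abs_continuous_on (time_slice E j) (\<lambda>t. x t j) \<and>
        (\<forall>s\<in>time_slice E j. \<forall>t\<in>time_slice E j. q s j = q t j) \<and>
        (\<forall>t\<in>interior (time_slice E j). x t j \<in> flow_set K (q t j)) \<and>
        (AE t in lebesgue. t \<in> interior (time_slice E j) \<longrightarrow>
           ((\<lambda>s. x s j) has_vector_derivative f (x t j) (flow_law K (q t j) (x t j))) (at t))) \<and>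
     (\<forall>t j. (t, j) \<in> E \<and> (t, Suc j) \<in> E \<longrightarrow>
        x t j \<in> jump_set K (q t j) \<and>
        x t (Suc j) = x t j \<and>
        q t (Suc j) \<in> jump_map K (q t j) (x t j))"

definition maximal_solution ::
  "('x::euclidean_space \<Rightarrow> real \<Rightarrow> 'x) \<Rightarrow> ('x, 'q) hybrid_feedback \<Rightarrow>
   (real \<times> nat) set \<Rightarrow> (real \<Rightarrow> nat \<Rightarrow> 'x) \<Rightarrow> (real \<Rightarrow> nat \<Rightarrow> 'q) \<Rightarrow> bool" where
  "maximal_solution f K E x q \<longleftrightarrow>
     closed_loop_solution f K E x q \<and>
     \<not> (\<exists>E' x' q'. closed_loop_solution f K E' x' q' \<and> E \<subset> E' \<and>
          (\<forall>(t, j)\<in>E. x' t j = x t j \<and> q' t j = q t j))"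

definition globally_asymptotically_stable ::
  "('x::euclidean_space \<Rightarrow> real \<Rightarrow> 'x) \<Rightarrow> ('x, 'q) hybrid_feedback \<Rightarrow> bool" where
  "globally_asymptotically_stable f K \<longleftrightarrow>
     (\<forall>\<epsilon>>0. \<exists>\<delta>>0. \<forall>E x q.
        closed_loop_solution f K E x q \<and> norm (x 0 0) \<le> \<delta> \<longrightarrow>
        (\<forall>(t, j)\<in>E. norm (x t j) \<le> \<epsilon>)) \<and>
     (\<forall>E x q. maximal_solution f K E x q \<longrightarrow>
        \<not> bounded ((\<lambda>(t, j). (t, real j)) ` E) \<and>
        (\<forall>\<epsilon>>0. \<exists>N. \<forall>(t, j)\<in>E. N \<le> t + real j \<longrightarrow> norm (x t j) \<le> \<epsilon>))"

section \<open>The plant\<close>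

definition f_h :: "real \<Rightarrow> real \<times> real \<Rightarrow> real \<Rightarrow> real \<times> real" where
  "f_h \<theta> = (\<lambda>(x1, x2) u. (x1 + x2 + \<theta> * x1\<^sup>2 + \<theta> * (1 + x1) * sin u, u))"

end

theory Submission
  imports Defs
begin

text \<open>
  A hybrid feedback with a single mode and an empty jump set is an ordinary continuous state
  feedback, and such a feedback suffices: with \<open>z = x2 + 2 * x1 + \<theta> * x1\<^sup>2\<close> take
  \<open>u = - (4 + x1\<^sup>2) * z\<close>. In the coordinates \<open>(x1, z)\<close> the first equation reads
  \<open>x1' = - x1 + z + \<theta> * (1 + x1) * sin u\<close>, so up to the sine term this is backstepping. The sine is
  treated as a perturbation. It is bounded, so for large \<open>x1\<close> the term \<open>\<theta> * (1 + x1) * sin u\<close> is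
  dominated by \<open>- x1\<close>. For small \<open>x1\<close> that argument fails, but there the gain is at most \<open>5\<close>, so
  \<open>\<bar>sin u\<bar> \<le> \<bar>u\<bar>\<close> bounds the perturbation by \<open>0.6 * \<bar>z\<bar>\<close>. Because \<open>\<theta>\<close> is small,
  \<open>V = x1\<^sup>2 / 2 + z\<^sup>2 / 4\<close> then satisfies \<open>V' \<le> - V / 2\<close> on the whole plane
  (\<open>lyapunov_form_negative\<close>).

  Exponential decay of \<open>V\<close> yields stability and convergence once two analytic points are settled.
  First, solutions are only absolutely continuous and satisfy the equation almost everywhere; the
  fundamental theorem of calculus for absolutely continuous functions
  (\<open>fundamental_theorem_of_calculus_abs_continuous\<close>) shows that they are classical solutions, so that
  \<open>V\<close> may be differentiated along them. Secondly, maximal solutions have to be complete. They stay in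
  a compact sublevel set of \<open>V\<close>; a bounded half-open interval of existence can be closed, and a
  compact one can be prolonged by Picard's theorem (\<open>picard_local_existence\<close>).
\<close>

section \<open>The fundamental theorem of calculus for absolutely continuous functions\<close>

text \<open>
  Tagged divisions are sets of pairs rather than sequences of intervals, so absolute continuity
  is needed for families of intervals over an arbitrary finite index set.
\<close>

lemma abs_continuous_on_interval_sum_less:
  assumes "abs_continuous_on_interval u v g" and "0 < \<epsilon>"
  shows "\<exists>\<delta>>0. \<forall>(S :: 'b set) a b. finite S \<longrightarrow> (\<forall>i\<in>S. u \<le> a i \<and> a i \<le> b i \<and> b i \<le> v) \<longrightarrow>
           (\<forall>i\<in>S. \<forall>k\<in>S. i \<noteq> k \<longrightarrow> {a i<..<b i} \<inter> {a k<..<b k} = {}) \<longrightarrow>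
           (\<Sum>i\<in>S. b i - a i) < \<delta> \<longrightarrow> (\<Sum>i\<in>S. norm (g (b i) - g (a i))) < \<epsilon>"
proof -
  obtain \<delta> where "\<delta> > 0" and \<delta>: "\<forall>(n::nat) a b.
        (\<forall>i<n. u \<le> a i \<and> a i \<le> b i \<and> b i \<le> v) \<and>
        (\<forall>i<n. \<forall>k<n. i \<noteq> k \<longrightarrow> {a i<..<b i} \<inter> {a k<..<b k} = {}) \<and>
        (\<Sum>i<n. b i - a i) < \<delta> \<longrightarrow>
        (\<Sum>i<n. norm (g (b i) - g (a i))) < \<epsilon>"
    using assms unfolding abs_continuous_on_interval_def by blast
  show ?thesis
  proof (intro exI[of _ \<delta>] conjI \<open>\<delta> > 0\<close> allI impI)
    fix S :: "'b set" and a b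
    assume fin: "finite S" and bnd: "\<forall>i\<in>S. u \<le> a i \<and> a i \<le> b i \<and> b i \<le> v"
      and dis: "\<forall>i\<in>S. \<forall>k\<in>S. i \<noteq> k \<longrightarrow> {a i<..<b i} \<inter> {a k<..<b k} = {}"
      and small: "(\<Sum>i\<in>S. b i - a i) < \<delta>"
    obtain h where h: "bij_betw h {..<card S} S"
      using ex_bij_betw_nat_finite[OF fin] by (auto simp: lessThan_atLeast0)
    have hS: "h i \<in> S" if "i < card S" for i
      using h that by (auto simp: bij_betw_def)
    have hinj: "h i \<noteq> h k" if "i < card S" "k < card S" "i \<noteq> k" for i k
      using h that by (auto simp: bij_betw_def inj_on_def)
    have "(\<Sum>i<card S. norm (g (b (h i)) - g (a (h i)))) < \<epsilon>"
    proof (rule \<delta>[rule_format], intro conjI)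
      show "(\<Sum>i<card S. b (h i) - a (h i)) < \<delta>"
        using sum.reindex_bij_betw[OF h, of "\<lambda>i. b i - a i"] small by simp
      show "\<forall>i<card S. u \<le> a (h i) \<and> a (h i) \<le> b (h i) \<and> b (h i) \<le> v"
        using bnd hS by blast
      show "\<forall>i<card S. \<forall>k<card S. i \<noteq> k \<longrightarrow>
              {a (h i)<..<b (h i)} \<inter> {a (h k)<..<b (h k)} = {}"
        using dis hS hinj by blast
    qed
    then show "(\<Sum>i\<in>S. norm (g (b i) - g (a i))) < \<epsilon>"
      using sum.reindex_bij_betw[OF h, of "\<lambda>i. norm (g (b i) - g (a i))"] by simp
  qed
qed

text \<open>
  The intervals of a division overlap only in null sets, so their lengths add up to the measure
  of their union.
\<close>

lemma tagged_division_sum_content_le_measure: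
  fixes a b :: real
  assumes div: "D tagged_division_of {a..b}" and sub: "D' \<subseteq> D"
    and T: "T \<in> lmeasurable" and in_T: "\<And>x K. (x, K) \<in> D' \<Longrightarrow> K \<subseteq> T"
  shows "(\<Sum>(x, K)\<in>D'. measure lborel K) \<le> measure lebesgue T"
proof -
  have fin: "finite D'"
    using div sub by (meson finite_subset tagged_division_of_finite)
  have box: "\<exists>c d. snd p = cbox c d" if "p \<in> D'" for p
    using tagged_division_ofD(4)[OF div, of "fst p" "snd p"] sub that by auto
  have meas: "snd p \<in> lmeasurable" if "p \<in> D'" for p
    using box[OF that] by auto
  have "(\<Sum>p\<in>D'. measure lborel (snd p)) = (\<Sum>p\<in>D'. measure lebesgue (snd p))"
  proof (rule sum.cong)
    show "measure lborel (snd p) = measure lebesgue (snd p)" if "p \<in> D'" for p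
      using box[OF that] by (auto simp: measure_completion)
  qed simp
  also have "\<dots> = measure lebesgue (\<Union>(snd ` D'))"
  proof (rule measure_negligible_finite_Union_image[symmetric])
    show "pairwise (\<lambda>p q. negligible (snd p \<inter> snd q)) D'"
    proof (rule pairwiseI)
      fix p q assume pq: "p \<in> D'" "q \<in> D'" "p \<noteq> q"
      then have "interior (snd p) \<inter> interior (snd q) = {}"
        using tagged_division_ofD(5)[OF div, of "fst p" "snd p" "fst q" "snd q"] sub by auto
      moreover have "convex (snd p \<inter> snd q)"
        using box[OF pq(1)] box[OF pq(2)] by (metis convex_Int convex_box(1))
      ultimately show "negligible (snd p \<inter> snd q)"
        by (simp add: negligible_convex_interior)
    qed
  qed (use fin meas in auto)
  also have "\<dots> \<le> measure lebesgue T"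
  proof (rule measure_mono_fmeasurable[OF _ _ T])
    show "\<Union>(snd ` D') \<subseteq> T" using in_T by fastforce
    show "\<Union>(snd ` D') \<in> sets lebesgue" using fin meas by (auto intro!: fmeasurableD)
  qed
  finally show ?thesis
    by (simp add: case_prod_unfold)
qed

text \<open>
  A Henstock gauge can treat the two kinds of tags separately. At a tag outside \<open>N\<close> it is so fine
  that the derivative controls the increment of \<open>g\<close>. At a tag in \<open>N\<close> it only forces the interval
  into an open set \<open>T \<supseteq> N\<close> of small measure; these intervals have small total length, and absolute
  continuity makes the total increment of \<open>g\<close> over them small.
\<close>

theorem fundamental_theorem_of_calculus_abs_continuous:
  fixes g :: "real \<Rightarrow> 'a::euclidean_space"
  assumes ab: "a \<le> b" and ac: "abs_continuous_on_interval a b g" and N: "negligible N"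
    and deriv: "\<And>t. t \<in> {a..b} - N \<Longrightarrow> (g has_vector_derivative F t) (at t within {a..b})"
  shows "(F has_integral (g b - g a)) {a..b}"
proof -
  \<comment> \<open>The integral does not see the values on \<open>N\<close>, and with the value \<open>0\<close> there the tags in \<open>N\<close>
    contribute nothing to the Riemann sum, even if \<open>F\<close> is unbounded.\<close>
  define F0 where "F0 t = (if t \<in> N then 0 else F t)" for t
  have "(F0 has_integral (g b - g a)) {a..b}"
    unfolding has_integral_factor_content_real
  proof (intro allI impI)
    fix e :: real assume e: "e > 0"
    show "\<exists>\<gamma>. gauge \<gamma> \<and> (\<forall>D. D tagged_division_of {a..b} \<and> \<gamma> fine D \<longrightarrow>
            norm ((\<Sum>(x, K)\<in>D. measure lborel K *\<^sub>R F0 x) - (g b - g a)) \<le> e * measure lborel {a..b})"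
    proof (cases "a = b")
      case True
      have "(\<Sum>(x, K)\<in>D. measure lborel K *\<^sub>R F0 x) = 0" if "D tagged_division_of {a..b}" for D
        using sum_content_null[of a b D F0] that True by (simp add: box_real[symmetric])
      with True show ?thesis
        by (intro exI[of _ "\<lambda>x. ball x 1"]) (auto simp: gauge_def)
    next
      case False
      with ab have "a < b" by simp
      define e' where "e' = e / 2"
      have e': "e' > 0" "e' * (b - a) > 0" "e = e' + e'"
        using e \<open>a < b\<close> by (auto simp: e'_def)
      obtain \<delta> where \<delta>0: "0 < \<delta>" and \<delta>: "\<forall>(S :: (real \<times> real set) set) l r. finite S \<longrightarrow>
           (\<forall>i\<in>S. a \<le> l i \<and> l i \<le> r i \<and> r i \<le> b) \<longrightarrow>
           (\<forall>i\<in>S. \<forall>k\<in>S. i \<noteq> k \<longrightarrow> {l i<..<r i} \<inter> {l k<..<r k} = {}) \<longrightarrow>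
           (\<Sum>i\<in>S. r i - l i) < \<delta> \<longrightarrow> (\<Sum>i\<in>S. norm (g (r i) - g (l i))) < e' * (b - a)"
        using abs_continuous_on_interval_sum_less[OF ac e'(2)] by blast
      obtain T where T: "open T" "N \<subseteq> T" "T \<in> lmeasurable" "measure lebesgue T < \<delta>"
      proof -
        have "N \<in> sets lebesgue"
          using N by (simp add: negligible_imp_sets)
        then obtain T where T: "open T" "N \<subseteq> T" "T - N \<in> lmeasurable"
            "emeasure lebesgue (T - N) < ennreal \<delta>"
          using sets_lebesgue_outer_open \<delta>0 by metis
        have eq: "T = (T - N) \<union> N" using T(2) by auto
        have Tm: "T \<in> lmeasurable"
          by (subst eq) (use T(3) N negligible_imp_measurable in blast)
        have "measure lebesgue T = measure lebesgue (T - N)"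
          using measure_Diff_null_set[of T lebesgue N] N Tm
          by (simp add: negligible_iff_null_sets fmeasurableD)
        moreover have "measure lebesgue (T - N) < \<delta>"
          using T(3,4) \<delta>0 by (simp add: emeasure_eq_measure2 ennreal_less_iff)
        ultimately show thesis
          using that T(1,2) Tm by simp
      qed
      have "\<forall>t. \<exists>d>0. t \<in> {a..b} - N \<longrightarrow> (\<forall>y\<in>{a..b}. \<bar>y - t\<bar> < d \<longrightarrow>
               norm (g y - g t - (y - t) *\<^sub>R F t) \<le> e' * \<bar>y - t\<bar>)"
      proof
        fix t show "\<exists>d>0. t \<in> {a..b} - N \<longrightarrow> (\<forall>y\<in>{a..b}. \<bar>y - t\<bar> < d \<longrightarrow>
               norm (g y - g t - (y - t) *\<^sub>R F t) \<le> e' * \<bar>y - t\<bar>)"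
        proof (cases "t \<in> {a..b} - N")
          case True
          from deriv[OF True] e'(1) show ?thesis
            unfolding has_vector_derivative_def has_derivative_within_alt by auto
        qed (auto intro: exI[of _ 1])
      qed
      from choice[OF this] obtain d where d0: "\<And>t. d t > 0" and d: "\<And>t y. t \<in> {a..b} - N \<Longrightarrow>
          y \<in> {a..b} \<Longrightarrow> \<bar>y - t\<bar> < d t \<Longrightarrow>
          norm (g y - g t - (y - t) *\<^sub>R F t) \<le> e' * \<bar>y - t\<bar>"
        by blast
      define \<gamma> where "\<gamma> t = (if t \<in> N then T else ball t (d t))" for t
      have "gauge \<gamma>"
        using T(1,2) d0 by (auto simp: gauge_def \<gamma>_def)
      moreover have "norm ((\<Sum>(x, K)\<in>D. measure lborel K *\<^sub>R F0 x) - (g b - g a)) \<le> e * measure lborel {a..b}"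
        if D: "D tagged_division_of {a..b}" and fine: "\<gamma> fine D" for D
      proof -
        note fin = tagged_division_of_finite[OF D]
        define D1 where "D1 = {p \<in> D. fst p \<in> N}"
        define D2 where "D2 = {p \<in> D. fst p \<notin> N}"
        have D12: "D = D1 \<union> D2" "D1 \<inter> D2 = {}" "D1 \<subseteq> D" "finite D1" "finite D2"
          using fin by (auto simp: D1_def D2_def)
        have box: "Inf K \<le> x" "x \<le> Sup K" "a \<le> Inf K" "Sup K \<le> b"
            "measure lborel K = Sup K - Inf K" "interior K = {Inf K<..<Sup K}" "{Inf K..Sup K} = K"
          if xK: "(x, K) \<in> D" for x K
        proof -
          obtain u v where uv: "K = {u..v}"
            using tagged_division_ofD(4)[OF D xK] by auto
          have "x \<in> K" "K \<subseteq> {a..b}"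
            using tagged_division_ofD(2,3)[OF D xK] by auto
          with uv show "Inf K \<le> x" "x \<le> Sup K" "a \<le> Inf K" "Sup K \<le> b"
            "measure lborel K = Sup K - Inf K" "interior K = {Inf K<..<Sup K}" "{Inf K..Sup K} = K"
            by auto
        qed
        define err where "err p = measure lborel (snd p) *\<^sub>R F0 (fst p) - (g (Sup (snd p)) - g (Inf (snd p)))"
          for p
        have "(\<Sum>(x, K)\<in>D. g (Sup K) - g (Inf K)) = g b - g a"
          using additive_tagged_division_1[OF ab D, of g] by simp
        then have "(\<Sum>(x, K)\<in>D. measure lborel K *\<^sub>R F0 x) - (g b - g a) = (\<Sum>p\<in>D. err p)"
          by (simp add: err_def case_prod_unfold sum_subtractf)
        also have "norm \<dots> \<le> (\<Sum>p\<in>D. norm (err p))"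
          by (rule norm_sum)
        also have "\<dots> = (\<Sum>p\<in>D1. norm (err p)) + (\<Sum>p\<in>D2. norm (err p))"
          unfolding D12(1) by (rule sum.union_disjoint[OF D12(4,5,2)])
        also have "(\<Sum>p\<in>D1. norm (err p)) \<le> e' * (b - a)"
        proof -
          have "(\<Sum>p\<in>D1. norm (err p)) = (\<Sum>p\<in>D1. norm (g (Sup (snd p)) - g (Inf (snd p))))"
            by (rule sum.cong) (auto simp: D1_def err_def F0_def norm_minus_commute[of "g (Inf _)"])
          also have "\<dots> < e' * (b - a)"
          proof (rule \<delta>[rule_format, OF D12(4)])
            show "a \<le> Inf (snd p) \<and> Inf (snd p) \<le> Sup (snd p) \<and> Sup (snd p) \<le> b" if "p \<in> D1" for p
              using box(1-4)[of "fst p" "snd p"] that by (auto simp: D1_def)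
            show "{Inf (snd p)<..<Sup (snd p)} \<inter> {Inf (snd q)<..<Sup (snd q)} = {}"
              if pq: "p \<in> D1" "q \<in> D1" "p \<noteq> q" for p q
            proof -
              have in_D: "(fst p, snd p) \<in> D" "(fst q, snd q) \<in> D"
                using pq by (auto simp: D1_def)
              have "interior (snd p) \<inter> interior (snd q) = {}"
                using tagged_division_ofD(5)[OF D in_D] pq(3) by (metis prod.collapse)
              then show ?thesis
                using box(6)[OF in_D(1)] box(6)[OF in_D(2)] by simp
            qed
            have "(\<Sum>p\<in>D1. Sup (snd p) - Inf (snd p)) = (\<Sum>(x, K)\<in>D1. measure lborel K)"
              using D12(3) by (intro sum.cong) (auto simp: box(5)[symmetric])
            also have "\<dots> \<le> measure lebesgue T"
            proof (rule tagged_division_sum_content_le_measure[OF D D12(3) T(3)])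
              show "K \<subseteq> T" if "(x, K) \<in> D1" for x K
                using fineD[OF fine, of x K] that by (auto simp: D1_def \<gamma>_def)
            qed
            finally show "(\<Sum>p\<in>D1. Sup (snd p) - Inf (snd p)) < \<delta>"
              using T(4) by simp
          qed
          finally show ?thesis by simp
        qed
        also have "(\<Sum>p\<in>D2. norm (err p)) \<le> (\<Sum>p\<in>D2. e' * measure lborel (snd p))"
        proof (rule sum_mono)
          fix p assume "p \<in> D2"
          then obtain x K where p: "p = (x, K)" and xK: "(x, K) \<in> D" and xN: "x \<notin> N"
            by (cases p) (auto simp: D2_def)
          define u v where "u = Inf K" and "v = Sup K"
          have K: "K = {u..v}" "u \<le> x" "x \<le> v" "a \<le> u" "v \<le> b" "measure lborel K = v - u"
            using box[OF xK] by (simp_all add: u_def v_def)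
          have "K \<subseteq> ball x (d x)"
            using fineD[OF fine xK] xN by (simp add: \<gamma>_def)
          moreover have "u \<in> K" "v \<in> K" using K by auto
          ultimately have "\<bar>u - x\<bar> < d x" "\<bar>v - x\<bar> < d x"
            by (auto simp: dist_real_def)
          then have *: "norm (g u - g x - (u - x) *\<^sub>R F x) \<le> e' * (x - u)"
            "norm (g v - g x - (v - x) *\<^sub>R F x) \<le> e' * (v - x)"
            using d[of x u] d[of x v] K xN by auto
          have "measure lborel K *\<^sub>R F x = v *\<^sub>R F x - u *\<^sub>R F x"
            unfolding K(6) by (rule scaleR_left_diff_distrib)
          then have "err p = (g u - g x - (u - x) *\<^sub>R F x) - (g v - g x - (v - x) *\<^sub>R F x)"
            using xN by (simp add: err_def p u_def[symmetric] v_def[symmetric] F0_def algebra_simps)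
          then have "norm (err p) \<le> e' * (x - u) + e' * (v - x)"
            using norm_triangle_le_diff[OF add_mono[OF *]] by simp
          then show "norm (err p) \<le> e' * measure lborel (snd p)"
            unfolding p snd_conv K(6) by (simp add: algebra_simps)
        qed
        also have "\<dots> \<le> (\<Sum>p\<in>D. e' * measure lborel (snd p))"
          using fin e'(1) by (intro sum_mono2) (auto simp: D2_def)
        also have "\<dots> = e' * (b - a)"
          using additive_content_tagged_division[of D a b] D ab
          by (simp add: sum_distrib_left[symmetric] case_prod_unfold)
        finally show ?thesis
          using e'(3) ab by (simp add: algebra_simps)
      qed
      ultimately show ?thesis by (intro exI[of _ \<gamma>] conjI allI impI) auto
    qed
  qed
  then show ?thesis
    by (rule has_integral_spike[OF N, rotated]) (simp add: F0_def)
qed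

section \<open>Local existence for Lipschitz vector fields\<close>

text \<open>
  Composing \<open>F\<close> with the metric projection onto the ball gives a bounded, globally Lipschitz field,
  for which the Picard operator is a contraction of the whole space of bounded continuous functions
  when \<open>h\<close> is small. The fixed point moves with speed at most \<open>M\<close>, so for \<open>h \<le> r / M\<close> it stays in the
  ball, where the projection is the identity.
\<close>

lemma picard_local_existence:
  fixes F :: "'a::euclidean_space \<Rightarrow> 'a"
  assumes r: "0 < r" and lip: "L-lipschitz_on (cball x0 r) F"
  obtains h y where "0 < h" and "y 0 = x0"
    and "\<And>t. t \<in> {0..h} \<Longrightarrow> y t \<in> cball x0 r"
    and "\<And>t. t \<in> {0..h} \<Longrightarrow> (y has_vector_derivative F (y t)) (at t within {0..h})"
proof -
  define G where "G = F \<circ> closest_point (cball x0 r)"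
  have L: "0 \<le> L" by (rule lipschitz_on_nonneg[OF lip])
  have proj: "closest_point (cball x0 r) z \<in> cball x0 r" for z
    using r by (intro closest_point_in_set) auto
  have G_lip: "norm (G z - G w) \<le> L * norm (z - w)" for z w
  proof -
    have "dist (G z) (G w) \<le> L * dist (closest_point (cball x0 r) z) (closest_point (cball x0 r) w)"
      unfolding G_def o_def by (rule lipschitz_onD[OF lip proj proj])
    also have "\<dots> \<le> L * dist z w"
      using r by (intro mult_left_mono closest_point_lipschitz L) auto
    finally show ?thesis by (simp add: dist_norm)
  qed
  have G_cont: "continuous_on S G" for S
    by (rule lipschitz_on_continuous_on[of L], rule lipschitz_onI)
       (use G_lip L in \<open>auto simp: dist_norm\<close>)
  obtain M where M: "M > 0" "\<And>z. norm (G z) \<le> M"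
  proof -
    have "bounded (F ` cball x0 r)"
      by (intro compact_imp_bounded compact_continuous_image lipschitz_on_continuous_on[OF lip]) simp
    then obtain M where "M > 0" "\<And>z. z \<in> cball x0 r \<Longrightarrow> norm (F z) \<le> M"
      unfolding bounded_pos by blast
    with that proj show thesis by (auto simp: G_def)
  qed
  define h where "h = min (1 / (2 * (L + 1))) (r / M)"
  have h: "h > 0" "h * L \<le> 1 / 2" "h * M \<le> r"
  proof -
    show "h > 0" using L r M by (auto simp: h_def)
    have "h * L \<le> 1 / (2 * (L + 1)) * L"
      using L by (intro mult_right_mono) (auto simp: h_def)
    also have "\<dots> \<le> 1 / 2" using L by (simp add: field_simps)
    finally show "h * L \<le> 1 / 2" .
    have "h * M \<le> r / M * M"
      using M by (intro mult_right_mono) (auto simp: h_def)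
    then show "h * M \<le> r" using M by simp
  qed
  \<comment> \<open>Constant continuation outside \<open>{0..h}\<close> turns functions on \<open>{0..h}\<close> into bounded continuous
    functions on the real line.\<close>
  define p where "p t = max 0 (min h t)" for t :: real
  have p: "p t \<in> {0..h}" for t using h by (auto simp: p_def)
  have p_id: "p t = t" if "t \<in> {0..h}" for t using that by (auto simp: p_def)
  have p_cont: "continuous_on UNIV p" unfolding p_def by (intro continuous_intros)
  define S :: "(real \<Rightarrow>\<^sub>C 'a) \<Rightarrow> real \<Rightarrow> 'a" where "S g t = x0 + integral {0..p t} (\<lambda>s. G (g s))" for g t
  have Gg_cont: "continuous_on A (\<lambda>s. G (apply_bcontfun g s))" for A g
    by (rule continuous_on_compose2[OF G_cont[of UNIV] continuous_on_apply_bcontfun]) simp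
  have Gg_int: "(\<lambda>s. G (apply_bcontfun g s)) integrable_on {0..c}"
    for g :: "real \<Rightarrow>\<^sub>C 'a" and c
    by (rule integrable_continuous_real[OF Gg_cont])
  have S_close: "norm (S g t - x0) \<le> h * M" for g t
  proof -
    have "norm (S g t - x0) \<le> M * (p t - 0)"
      unfolding S_def add_diff_cancel_left'
      using p[of t] M by (intro integral_bound Gg_cont) auto
    also have "\<dots> \<le> M * h" using p[of t] M by (intro mult_left_mono) auto
    finally show ?thesis by (simp add: mult.commute)
  qed
  have S_bcont: "S g \<in> bcontfun" for g
  proof (rule bcontfun_normI)
    have "continuous_on {0..h} (\<lambda>u. integral {0..u} (\<lambda>s. G (g s)))"
      by (rule indefinite_integral_continuous_1[OF Gg_int])
    then have "continuous_on UNIV (\<lambda>t. integral {0..p t} (\<lambda>s. G (g s)))"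
      by (rule continuous_on_compose2[OF _ p_cont]) (use p in auto)
    then show "continuous_on UNIV (S g)"
      unfolding S_def by (intro continuous_intros)
    show "norm (S g t) \<le> norm x0 + h * M" for t
      using S_close[of g t] norm_triangle_sub[of "S g t" x0] by simp
  qed
  have "\<exists>!g. Bcontfun (S g) = g"
  proof (rule banach_fix_type[of "1 / 2"])
    show "\<forall>g g'. dist (Bcontfun (S g)) (Bcontfun (S g')) \<le> 1 / 2 * dist g g'"
    proof (intro allI dist_bound)
      fix g g' :: "real \<Rightarrow>\<^sub>C 'a" and t
      have "S g t - S g' t = integral {0..p t} (\<lambda>s. G (g s) - G (g' s))"
        unfolding S_def by (simp add: integral_diff[OF Gg_int Gg_int])
      also have "norm \<dots> \<le> (L * dist g g') * (p t - 0)"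
      proof (rule integral_bound)
        show "norm (G (g s) - G (g' s)) \<le> L * dist g g'" for s
        proof -
          have "norm (G (g s) - G (g' s)) \<le> L * norm (g s - g' s)" by (rule G_lip)
          also have "\<dots> \<le> L * dist g g'"
            using dist_bounded[of g s g'] L by (intro mult_left_mono) (auto simp: dist_norm)
          finally show ?thesis .
        qed
      qed (use p[of t] in \<open>auto intro: continuous_on_diff[OF Gg_cont Gg_cont]\<close>)
      also have "\<dots> \<le> (L * dist g g') * h"
        using p[of t] L by (intro mult_left_mono) auto
      also have "\<dots> = (h * L) * dist g g'" by simp
      also have "\<dots> \<le> 1 / 2 * dist g g'"
        by (intro mult_right_mono h) simp
      finally show "dist (Bcontfun (S g) t) (Bcontfun (S g') t) \<le> 1 / 2 * dist g g'"
        by (simp add: Bcontfun_inverse S_bcont dist_norm)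
    qed
  qed auto
  then obtain g where "Bcontfun (S g) = g" by blast
  then have g: "g t = S g t" for t
    using Bcontfun_inverse[OF S_bcont[of g]] by simp
  show thesis
  proof (rule that[OF h(1)])
    show "g 0 = x0" unfolding g[of 0] S_def using h(1) by (simp add: p_def)
    show in_ball: "g t \<in> cball x0 r" if "t \<in> {0..h}" for t
      using S_close[of g t] h(3) unfolding g[of t] by (simp add: dist_norm norm_minus_commute)
    fix t assume t: "t \<in> {0..h}"
    have "((\<lambda>u. x0 + integral {0..u} (\<lambda>s. G (g s))) has_vector_derivative 0 + G (g t)) (at t within {0..h})"
      by (intro has_vector_derivative_add has_vector_derivative_const integral_has_vector_derivative t Gg_cont)
    then have "((\<lambda>u. x0 + integral {0..u} (\<lambda>s. G (g s))) has_vector_derivative F (g t)) (at t within {0..h})"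
      using in_ball[OF t] by (simp add: G_def closest_point_self)
    moreover have "g u = x0 + integral {0..u} (\<lambda>s. G (g s))" if "u \<in> {0..h}" for u
      unfolding g[of u] S_def p_id[OF that] ..
    ultimately show "(g has_vector_derivative F (g t)) (at t within {0..h})"
      by (rule has_vector_derivative_transform[OF t, rotated])
  qed
qed

section \<open>Absolutely continuous solutions and their continuation\<close>

text \<open>
  The requirements on a closed-loop solution along one interval of flow. An interval with empty
  interior imposes nothing, so a single point is always a solution.
\<close>

definition caratheodory_solution :: "('a::euclidean_space \<Rightarrow> 'a) \<Rightarrow> real set \<Rightarrow> (real \<Rightarrow> 'a) \<Rightarrow> bool" where
  "caratheodory_solution F I x \<longleftrightarrow>
     (interior I \<noteq> {} \<longrightarrow>
        loc_abs_continuous_on I x \<and>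
        (AE t in lebesgue. t \<in> interior I \<longrightarrow> (x has_vector_derivative F (x t)) (at t)))"

lemma abs_continuous_imp_continuous_on:
  assumes "abs_continuous_on_interval a b g"
  shows "continuous_on {a..b} g"
  unfolding continuous_on_iff
proof (intro ballI allI impI)
  fix t e :: real assume t: "t \<in> {a..b}" and "0 < e"
  then obtain \<delta> where \<delta>: "\<delta> > 0" "\<forall>(n::nat) l r.
        (\<forall>i<n. a \<le> l i \<and> l i \<le> r i \<and> r i \<le> b) \<and>
        (\<forall>i<n. \<forall>k<n. i \<noteq> k \<longrightarrow> {l i<..<r i} \<inter> {l k<..<r k} = {}) \<and>
        (\<Sum>i<n. r i - l i) < \<delta> \<longrightarrow> (\<Sum>i<n. norm (g (r i) - g (l i))) < e"
    using assms unfolding abs_continuous_on_interval_def by blast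
  have *: "norm (g v - g u) < e" if "a \<le> u" "u \<le> v" "v \<le> b" "v - u < \<delta>" for u v
    using \<delta>(2)[rule_format, of 1 "\<lambda>_. u" "\<lambda>_. v"] that by simp
  show "\<exists>d>0. \<forall>s\<in>{a..b}. dist s t < d \<longrightarrow> dist (g s) (g t) < e"
  proof (intro exI[of _ \<delta>] conjI \<delta>(1) ballI impI)
    fix s assume "s \<in> {a..b}" "dist s t < \<delta>"
    then show "dist (g s) (g t) < e"
      using *[of s t] *[of t s] t by (cases "s \<le> t") (auto simp: dist_norm norm_minus_commute)
  qed
qed

lemma lipschitz_imp_abs_continuous:
  assumes lip: "L-lipschitz_on {a..b} g"
  shows "abs_continuous_on_interval a b g"
  unfolding abs_continuous_on_interval_def
proof (intro allI impI)
  fix e :: real assume e: "0 < e"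
  have L: "0 \<le> L" by (rule lipschitz_on_nonneg[OF lip])
  show "\<exists>\<delta>>0. \<forall>(n::nat) l r.
        (\<forall>i<n. a \<le> l i \<and> l i \<le> r i \<and> r i \<le> b) \<and>
        (\<forall>i<n. \<forall>k<n. i \<noteq> k \<longrightarrow> {l i<..<r i} \<inter> {l k<..<r k} = {}) \<and>
        (\<Sum>i<n. r i - l i) < \<delta> \<longrightarrow> (\<Sum>i<n. norm (g (r i) - g (l i))) < e"
  proof (intro exI[of _ "e / (L + 1)"] conjI allI impI)
    show "0 < e / (L + 1)" using e L by simp
    fix n :: nat and l r
    assume H: "(\<forall>i<n. a \<le> l i \<and> l i \<le> r i \<and> r i \<le> b) \<and>
        (\<forall>i<n. \<forall>k<n. i \<noteq> k \<longrightarrow> {l i<..<r i} \<inter> {l k<..<r k} = {}) \<and>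
        (\<Sum>i<n. r i - l i) < e / (L + 1)"
    have "(\<Sum>i<n. norm (g (r i) - g (l i))) \<le> (\<Sum>i<n. L * (r i - l i))"
    proof (rule sum_mono)
      fix i assume "i \<in> {..<n}"
      then show "norm (g (r i) - g (l i)) \<le> L * (r i - l i)"
        using lipschitz_on_normD[OF lip, of "r i" "l i"] H by auto
    qed
    also have "\<dots> = L * (\<Sum>i<n. r i - l i)" by (rule sum_distrib_left[symmetric])
    also have "\<dots> \<le> L * (e / (L + 1))" using H L by (intro mult_left_mono) auto
    also have "\<dots> < e" using L e by (simp add: field_simps)
    finally show "(\<Sum>i<n. norm (g (r i) - g (l i))) < e" .
  qed
qed

text \<open>
  The right-hand side is continuous along an absolutely continuous solution, so the integral
  equation improves the almost everywhere derivative to a derivative everywhere, one-sided at the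
  end points.
\<close>

lemma caratheodory_solution_classical:
  fixes F :: "'a::euclidean_space \<Rightarrow> 'a"
  assumes F: "continuous_on UNIV F" and sol: "caratheodory_solution F I x"
    and sub: "{a..b} \<subseteq> I" and t: "t \<in> {a..b}"
  shows "(x has_vector_derivative F (x t)) (at t within {a..b})"
proof (cases "a = b")
  case True
  with t show ?thesis
    by (simp add: has_vector_derivative_def has_derivative_within_singleton_iff bounded_linear_scaleR_left)
next
  case False
  with t have ab: "a < b" by auto
  have inside: "{a<..<b} \<subseteq> interior I"
    using interior_mono[OF sub] by simp
  with ab have ne: "interior I \<noteq> {}"
    using dense[OF ab] by auto
  have ac: "abs_continuous_on_interval u v x" if "u \<le> v" "{u..v} \<subseteq> I" for u v
    using sol ne that by (simp add: caratheodory_solution_def loc_abs_continuous_on_def)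
  have Fx: "continuous_on {a..b} (\<lambda>s. F (x s))"
    using abs_continuous_imp_continuous_on[OF ac[OF _ sub]] ab
    by (intro continuous_on_compose2[OF F]) auto
  obtain N where N: "negligible N"
    "\<And>s. s \<in> interior I - N \<Longrightarrow> (x has_vector_derivative F (x s)) (at s)"
    using sol ne unfolding caratheodory_solution_def eventually_ae_filter negligible_iff_null_sets
    by (auto simp: subset_iff)
  have "x u = x a + integral {a..u} (\<lambda>s. F (x s))" if u: "u \<in> {a..b}" for u
  proof -
    have "((\<lambda>s. F (x s)) has_integral x u - x a) {a..u}"
    proof (rule fundamental_theorem_of_calculus_abs_continuous)
      show "a \<le> u" using u by simp
      show "abs_continuous_on_interval a u x" using u sub by (intro ac) auto
      show "negligible (N \<union> {a, b})" using N(1) by simp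
      fix s assume "s \<in> {a..u} - (N \<union> {a, b})"
      then have "s \<in> interior I - N" using u by (auto intro: subsetD[OF inside])
      then show "(x has_vector_derivative F (x s)) (at s within {a..u})"
        by (rule has_vector_derivative_at_within[OF N(2)])
    qed
    from integral_unique[OF this] show ?thesis by simp
  qed
  note integral_eq = this
  have "((\<lambda>u. x a + integral {a..u} (\<lambda>s. F (x s))) has_vector_derivative 0 + F (x t)) (at t within {a..b})"
    by (intro has_vector_derivative_add has_vector_derivative_const integral_has_vector_derivative t Fx)
  then have "((\<lambda>u. x a + integral {a..u} (\<lambda>s. F (x s))) has_vector_derivative F (x t)) (at t within {a..b})"
    by simp
  then show ?thesis
    by (rule has_vector_derivative_transform[OF t, rotated]) (rule integral_eq)
qed

lemma caratheodory_solution_continuous_on: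
  assumes "continuous_on UNIV F" and "caratheodory_solution F I x" and "{a..b} \<subseteq> I"
  shows "continuous_on {a..b} x"
  unfolding continuous_on_eq_continuous_within
  using caratheodory_solution_classical[OF assms] has_vector_derivative_continuous by blast

lemma caratheodory_solution_lipschitz:
  assumes "continuous_on UNIV F" and "caratheodory_solution F I x" and "{a..b} \<subseteq> I"
    and M: "0 \<le> M" "\<And>t. t \<in> {a..b} \<Longrightarrow> norm (F (x t)) \<le> M"
  shows "M-lipschitz_on {a..b} x"
proof (rule bounded_derivative_imp_lipschitz)
  show "(x has_derivative (\<lambda>h. h *\<^sub>R F (x t))) (at t within {a..b})" if "t \<in> {a..b}" for t
    using caratheodory_solution_classical[OF assms(1-3) that] by (simp add: has_vector_derivative_def)
  show "onorm (\<lambda>h. h *\<^sub>R F (x t)) \<le> M" if "t \<in> {a..b}" for t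
    using M(2)[OF that] by (intro onorm_le) (simp add: mult.commute[of M] mult_left_mono)
qed (use M in auto)

text \<open>
  In a compact set the speed is bounded, so the solution is Lipschitz and has a limit at \<open>T\<close>.
\<close>

lemma caratheodory_solution_extend_to_closed:
  fixes F :: "'a::euclidean_space \<Rightarrow> 'a"
  assumes F: "continuous_on UNIV F" and sol: "caratheodory_solution F {0..<T} x"
    and K: "compact K" "\<And>t. t \<in> {0..<T} \<Longrightarrow> x t \<in> K" and T: "0 < T"
  obtains y where "caratheodory_solution F {0..T} y" and "\<And>t. t \<in> {0..<T} \<Longrightarrow> y t = x t"
proof -
  have "bounded (F ` K)"
    using F K(1) by (meson compact_continuous_image compact_imp_bounded continuous_on_subset subset_UNIV)
  then obtain M where M: "M > 0" "\<And>z. z \<in> K \<Longrightarrow> norm (F z) \<le> M"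
    unfolding bounded_pos by blast
  have "M-lipschitz_on {0..<T} x"
  proof (rule lipschitz_on_leI)
    fix s t assume st: "s \<in> {0..<T}" "t \<in> {0..<T}" "s \<le> t"
    then have "M-lipschitz_on {s..t} x"
      using M K(2) by (intro caratheodory_solution_lipschitz[OF F sol]) auto
    then show "dist (x s) (x t) \<le> M * dist s t"
      by (rule lipschitz_onD) (use st in auto)
  qed (use M in simp)
  from lipschitz_extend_closure[OF this] obtain y
    where lip: "M-lipschitz_on {0..T} y" and yx: "\<And>t. t \<in> {0..<T} \<Longrightarrow> y t = x t"
    using T by (auto simp: closure_atLeastLessThan)
  have "(y has_vector_derivative F (y t)) (at t)" if t: "t \<in> {0<..<T}" for t
  proof -
    obtain s where s: "t < s" "s < T" using dense t by auto
    have "(x has_vector_derivative F (x t)) (at t within {0..s})"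
      using s t by (intro caratheodory_solution_classical[OF F sol]) auto
    then have "(x has_vector_derivative F (y t)) (at t)"
      using s t yx[of t] by (simp add: at_within_Icc_at)
    then show ?thesis
      by (rule has_vector_derivative_transform_within_open[OF _ open_greaterThanLessThan t])
         (simp add: yx)
  qed
  moreover have "loc_abs_continuous_on {0..T} y"
    unfolding loc_abs_continuous_on_def
    using lipschitz_imp_abs_continuous lipschitz_on_subset[OF lip] by blast
  ultimately have "caratheodory_solution F {0..T} y"
    by (auto simp: caratheodory_solution_def)
  with yx that show thesis by blast
qed

text \<open>
  A local solution started at \<open>x b\<close> is appended. Both pieces are Lipschitz, hence so is the
  concatenation, and the possible kink at \<open>b\<close> is a null set.
\<close>

lemma caratheodory_solution_extend_beyond:
  fixes F :: "'a::euclidean_space \<Rightarrow> 'a"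
  assumes F: "continuous_on UNIV F" and r: "0 < r" and lipF: "L-lipschitz_on (cball (x b) r) F"
    and sol: "caratheodory_solution F {0..b} x" and b: "0 \<le> b"
  obtains h y where "0 < h" and "caratheodory_solution F {0..b + h} y"
    and "\<And>t. t \<in> {0..b} \<Longrightarrow> y t = x t"
proof -
  obtain h z where h: "0 < h" and z0: "z 0 = x b"
    and z_ball: "\<And>t. t \<in> {0..h} \<Longrightarrow> z t \<in> cball (x b) r"
    and z: "\<And>t. t \<in> {0..h} \<Longrightarrow> (z has_vector_derivative F (z t)) (at t within {0..h})"
    by (rule picard_local_existence[OF r lipF]) blast
  define y where "y t = (if t \<le> b then x t else z (t - b))" for t
  have "continuous_on {0..b} (\<lambda>t. F (x t))"
    by (rule continuous_on_compose2[OF F caratheodory_solution_continuous_on[OF F sol]]) auto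
  then have "bounded ((\<lambda>t. F (x t)) ` {0..b} \<union> F ` cball (x b) r)"
    using F by (auto intro!: compact_imp_bounded compact_continuous_image intro: continuous_on_subset)
  then obtain M where M: "M > 0" "\<And>t. t \<in> {0..b} \<Longrightarrow> norm (F (x t)) \<le> M"
    "\<And>w. w \<in> cball (x b) r \<Longrightarrow> norm (F w) \<le> M"
    unfolding bounded_pos by blast
  have x_lip: "M-lipschitz_on {0..b} x"
    using M by (intro caratheodory_solution_lipschitz[OF F sol]) auto
  have "M-lipschitz_on {0..h} z"
  proof (rule bounded_derivative_imp_lipschitz)
    show "(z has_derivative (\<lambda>s. s *\<^sub>R F (z t))) (at t within {0..h})" if "t \<in> {0..h}" for t
      using z[OF that] by (simp add: has_vector_derivative_def)
    show "onorm (\<lambda>s. s *\<^sub>R F (z t)) \<le> M" if "t \<in> {0..h}" for t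
      using M(3)[OF z_ball[OF that]] by (intro onorm_le) (simp add: mult.commute[of M] mult_left_mono)
  qed (use M in auto)
  note z_lip = this
  have "M-lipschitz_on {b..b + h} (\<lambda>t. z (t - b))"
  proof (rule lipschitz_onI)
    show "dist (z (s - b)) (z (t - b)) \<le> M * dist s t" if "s \<in> {b..b + h}" "t \<in> {b..b + h}" for s t
      using lipschitz_onD[OF z_lip, of "s - b" "t - b"] that by (simp add: dist_real_def)
  qed (use M in simp)
  then have y_lip: "M-lipschitz_on {0..b + h} y"
    unfolding y_def by (intro lipschitz_on_concat x_lip) (simp_all add: z0)
  have deriv: "(y has_vector_derivative F (y t)) (at t)" if t: "t \<in> {0<..<b + h}" "t \<noteq> b" for t
  proof (cases "t < b")
    case True
    have "(x has_vector_derivative F (x t)) (at t within {0..b})"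
      using True t by (intro caratheodory_solution_classical[OF F sol]) auto
    then have "(x has_vector_derivative F (y t)) (at t)"
      using True t by (simp add: at_within_Icc_at y_def)
    then show ?thesis
      by (rule has_vector_derivative_transform_within_open[where S = "{..<b}"])
         (use True in \<open>auto simp: y_def\<close>)
  next
    case False
    with t have tb: "0 < t - b" "t - b < h" by auto
    have "(z has_vector_derivative F (z (t - b))) (at (t - b))"
      using z[of "t - b"] tb by (simp add: at_within_Icc_at)
    then have "(z has_vector_derivative F (y t)) (at (t - b))"
      using tb by (simp add: y_def)
    moreover have "((\<lambda>s. s - b) has_vector_derivative 1) (at t)"
      by (auto intro!: derivative_eq_intros)
    ultimately have "((\<lambda>s. z (s - b)) has_vector_derivative F (y t)) (at t)"
      using vector_diff_chain_at[of "\<lambda>s. s - b" 1 t z "F (y t)"] by (simp add: o_def)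
    then show ?thesis
      by (rule has_vector_derivative_transform_within_open[where S = "{b<..}"])
         (use tb in \<open>auto simp: y_def\<close>)
  qed
  have "AE t in lebesgue. t \<in> interior {0..b + h} \<longrightarrow> (y has_vector_derivative F (y t)) (at t)"
    by (rule AE_I'[of "{b}"]) (use deriv in \<open>auto simp: negligible_iff_null_sets[symmetric]\<close>)
  moreover have "loc_abs_continuous_on {0..b + h} y"
    unfolding loc_abs_continuous_on_def
    using lipschitz_imp_abs_continuous lipschitz_on_subset[OF y_lip] by blast
  ultimately have "caratheodory_solution F {0..b + h} y"
    by (simp add: caratheodory_solution_def)
  with that[OF h] show thesis by (simp add: y_def)
qed

lemma lyapunov_exponential_decay:
  fixes F :: "'a::euclidean_space \<Rightarrow> 'a" and V :: "'a \<Rightarrow> real"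
  assumes F: "continuous_on UNIV F" and sol: "caratheodory_solution F I x"
    and t: "0 \<le> t" "{0..t} \<subseteq> I"
    and V: "\<And>z. (V has_derivative V' z) (at z)" and decay: "\<And>z. V' z (F z) \<le> - c * V z"
  shows "V (x t) \<le> exp (- c * t) * V (x 0)"
proof -
  have "exp (c * t) * V (x t) \<le> exp (c * 0) * V (x 0)"
  proof (rule DERIV_nonpos_imp_decreasing_open[OF t(1)])
    fix s assume s: "0 < s" "s < t"
    have "(x has_vector_derivative F (x s)) (at s)"
      using caratheodory_solution_classical[OF F sol t(2), of s] s by (simp add: at_within_Icc_at)
    then have "((\<lambda>s. V (x s)) has_real_derivative V' (x s) (F (x s))) (at s)"
      using vector_derivative_diff_chain_within[of x _ s UNIV V, OF _ has_derivative_at_withinI[OF V]]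
      by (simp add: has_real_derivative_iff_has_vector_derivative o_def)
    then have "((\<lambda>s. exp (c * s) * V (x s)) has_real_derivative
                 exp (c * s) * (c * V (x s) + V' (x s) (F (x s)))) (at s)"
      by (auto intro!: derivative_eq_intros simp: algebra_simps)
    moreover have "exp (c * s) * (c * V (x s) + V' (x s) (F (x s))) \<le> 0"
      using decay[of "x s"] by (intro mult_nonneg_nonpos) auto
    ultimately show "\<exists>y. ((\<lambda>s. exp (c * s) * V (x s)) has_real_derivative y) (at s) \<and> y \<le> 0"
      by blast
  next
    have "continuous_on UNIV V"
      using has_derivative_continuous[OF V] by (auto simp: continuous_on_eq_continuous_at)
    then have "continuous_on {0..t} (\<lambda>s. V (x s))"
      by (rule continuous_on_compose2[OF _ caratheodory_solution_continuous_on[OF F sol t(2)]]) simp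
    then show "continuous_on {0..t} (\<lambda>s. exp (c * s) * V (x s))"
      by (intro continuous_intros)
  qed
  then show ?thesis
    by (simp add: exp_minus field_simps)
qed

section \<open>Continuous feedbacks as hybrid feedbacks\<close>

definition static_feedback :: "('x \<Rightarrow> real) \<Rightarrow> ('x::euclidean_space, nat) hybrid_feedback" where
  "static_feedback \<phi> =
     \<lparr>modes = {0}, mode_order = {(0, 0)}, flow_set = (\<lambda>_. UNIV), jump_set = (\<lambda>_. {}),
      flow_law = (\<lambda>_. \<phi>), jump_map = (\<lambda>_ _. {0})\<rparr>"

lemma static_feedback_simps [simp]:
  "modes (static_feedback \<phi>) = {0}" "mode_order (static_feedback \<phi>) = {(0, 0)}"
  "flow_set (static_feedback \<phi>) q = UNIV" "jump_set (static_feedback \<phi>) q = {}"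
  "flow_law (static_feedback \<phi>) q = \<phi>" "jump_map (static_feedback \<phi>) q z = {0}"
  by (simp_all add: static_feedback_def)

lemma is_hybrid_feedback_static_feedback:
  assumes "continuous_on UNIV \<phi>"
  shows "is_hybrid_feedback (static_feedback \<phi>)"
  using assms
  by (auto simp: is_hybrid_feedback_def outer_semicontinuous_map_def linear_order_on_def
      partial_order_on_def preorder_on_def refl_on_def trans_def antisym_def total_on_def)

lemma time_slice_Times: "time_slice (I \<times> {0}) j = (if j = 0 then I else {})"
  by (auto simp: time_slice_def)

text \<open>
  The possible time intervals of a solution that never jumps.
\<close>

definition initial_interval :: "real set \<Rightarrow> bool" where
  "initial_interval I \<longleftrightarrow> (\<exists>b\<ge>0. I = {0..b}) \<or> (\<exists>T>0. I = {0..<T}) \<or> I = {0..}"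

lemma hybrid_time_domain_without_jumps:
  assumes dom: "hybrid_time_domain E" and no_jump: "\<And>s j. (s, j) \<in> E \<Longrightarrow> (s, Suc j) \<notin> E"
  obtains I where "initial_interval I" and "E = I \<times> {0}"
proof -
  obtain t :: "nat \<Rightarrow> real" where t: "t 0 = 0" "incseq t"
    and E: "E = (\<Union>j. {t j..t (Suc j)} \<times> {j}) \<or>
       (\<exists>J I. E = (\<Union>j<J. {t j..t (Suc j)} \<times> {j}) \<union> I \<times> {J} \<and>
          (I = {t J..t (Suc J)} \<or> (\<exists>T::ereal. ereal (t J) < T \<and> I = {s. t J \<le> s \<and> ereal s < T})))"
    using dom unfolding hybrid_time_domain_def by blast
  have le: "t j \<le> t (Suc j)" for j
    using t(2) by (simp add: incseq_SucD)
  from E show thesis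
  proof (elim disjE exE conjE)
    assume E: "E = (\<Union>j. {t j..t (Suc j)} \<times> {j})"
    have "(t 1, 0) \<in> E" "(t 1, Suc 0) \<in> E"
      unfolding E using le[of 0] le[of 1] by auto
    with no_jump show thesis by blast
  next
    fix J I assume E: "E = (\<Union>j<J. {t j..t (Suc j)} \<times> {j}) \<union> I \<times> {J}"
      and "I = {t J..t (Suc J)}"
    then have I: "t J \<in> I" "J = 0 \<Longrightarrow> initial_interval I"
      using le[of J] t(1) by (auto simp: initial_interval_def)
    show thesis
    proof (cases J)
      case 0
      with E I(2) that[of I] show thesis by simp
    next
      case (Suc j)
      then have "(t J, j) \<in> E" "(t J, Suc j) \<in> E"
        unfolding E using le[of j] I(1) by auto
      with no_jump show thesis by blast
    qed
  next
    fix J I and T :: ereal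
    assume E: "E = (\<Union>j<J. {t j..t (Suc j)} \<times> {j}) \<union> I \<times> {J}"
      and T: "ereal (t J) < T" "I = {s. t J \<le> s \<and> ereal s < T}"
    then have I: "t J \<in> I" by auto
    show thesis
    proof (cases J)
      case 0
      have "initial_interval I"
        using T 0 t(1) by (cases T) (auto simp: initial_interval_def atLeastLessThan_def atLeast_def lessThan_def)
      with E 0 that[of I] show thesis by simp
    next
      case (Suc j)
      then have "(t J, j) \<in> E" "(t J, Suc j) \<in> E"
        unfolding E using le[of j] I(1) by auto
      with no_jump show thesis by blast
    qed
  qed
qed

lemma hybrid_time_domain_initial_interval:
  assumes "initial_interval I"
  shows "hybrid_time_domain (I \<times> {0})"
proof -
  define t where "t b n = (if n = 0 then 0 else b)" for b :: real and n :: nat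
  have t: "t b 0 = 0" "0 \<le> b \<Longrightarrow> incseq (t b)" for b
    by (auto simp: t_def incseq_def)
  consider b where "0 \<le> b" "I = {0..b}" | T where "0 < T" "I = {0..<T}" | "I = {0..}"
    using assms unfolding initial_interval_def by blast
  then show ?thesis
  proof cases
    case 1
    then show ?thesis
      unfolding hybrid_time_domain_def
      by (intro exI[of _ "t b"] conjI t(1) t(2)[OF 1(1)], intro disjI2[OF exI[of _ 0]] exI[of _ I])
         (auto simp: t_def)
  next
    case 2
    then show ?thesis
      unfolding hybrid_time_domain_def
      by (intro exI[of _ "t 0"] conjI t disjI2 exI[of _ 0] exI[of _ I] exI[of _ "ereal T"]) (auto simp: t_def)
  next
    case 3
    then show ?thesis
      unfolding hybrid_time_domain_def
      by (intro exI[of _ "t 0"] conjI t disjI2 exI[of _ 0] exI[of _ I] exI[of _ "\<infinity>"]) (auto simp: t_def)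
  qed
qed

lemma closed_loop_solution_static_feedbackE:
  assumes "closed_loop_solution f (static_feedback \<phi>) E x q"
  obtains I where "initial_interval I" and "E = I \<times> {0}"
    and "\<forall>t\<in>I. q t 0 = 0"
    and "caratheodory_solution (\<lambda>z. f z (\<phi> z)) I (\<lambda>t. x t 0)"
proof -
  note sol = assms[unfolded closed_loop_solution_def]
  have "hybrid_time_domain E" using sol by blast
  moreover have "(s, Suc j) \<notin> E" if "(s, j) \<in> E" for s j
    using sol that by auto
  ultimately obtain I where I: "initial_interval I" "E = I \<times> {0}"
    using hybrid_time_domain_without_jumps by metis
  show thesis
  proof (rule that[OF I])
    show "\<forall>t\<in>I. q t 0 = 0"
      using sol I(2) by auto
    have "interior (time_slice E 0) \<noteq> {} \<longrightarrow>
        loc_abs_continuous_on (time_slice E 0) (\<lambda>t. x t 0) \<and>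
        (AE t in lebesgue. t \<in> interior (time_slice E 0) \<longrightarrow>
           ((\<lambda>s. x s 0) has_vector_derivative f (x t 0) (\<phi> (x t 0))) (at t))"
      using sol by simp
    then show "caratheodory_solution (\<lambda>z. f z (\<phi> z)) I (\<lambda>t. x t 0)"
      unfolding I(2) time_slice_Times caratheodory_solution_def by simp
  qed
qed

lemma closed_loop_solution_static_feedbackI:
  assumes I: "initial_interval I" and sol: "caratheodory_solution (\<lambda>z. f z (\<phi> z)) I y"
  shows "closed_loop_solution f (static_feedback \<phi>) (I \<times> {0}) (\<lambda>t j. y t) (\<lambda>t j. 0)"
  using sol hybrid_time_domain_initial_interval[OF I]
  by (auto simp: closed_loop_solution_def caratheodory_solution_def time_slice_Times)

text \<open>
  Exponential decay of \<open>V\<close> gives stability and convergence. What remains is that a maximal solution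
  lives on all of \<open>{0..}\<close>: it stays in the compact sublevel set of its initial value, so on
  \<open>{0..<T}\<close> it can be closed up at \<open>T\<close>, and on \<open>{0..b}\<close> the local Lipschitz condition
  continues it beyond \<open>b\<close>; either contradicts maximality.
\<close>

theorem static_feedback_globally_asymptotically_stable:
  fixes f :: "'x::euclidean_space \<Rightarrow> real \<Rightarrow> 'x" and \<phi> V :: "'x \<Rightarrow> real"
  defines "F \<equiv> \<lambda>z. f z (\<phi> z)"
  assumes lip: "\<And>z. \<exists>r>0. \<exists>L. L-lipschitz_on (cball z r) F"
    and V: "\<And>z. (V has_derivative V' z) (at z)" and V0: "V 0 = 0" and V_nonneg: "\<And>z. 0 \<le> V z"
    and decay: "\<And>z. V' z (F z) \<le> - c * V z" and c: "0 < c"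
    and small: "\<And>\<epsilon>. 0 < \<epsilon> \<Longrightarrow> \<exists>w>0. \<forall>z. V z \<le> w \<longrightarrow> norm z \<le> \<epsilon>"
    and bdd: "\<And>w. bounded {z. V z \<le> w}"
  shows "globally_asymptotically_stable f (static_feedback \<phi>)"
proof -
  have F: "continuous_on UNIV F"
    unfolding continuous_on_eq_continuous_at[OF open_UNIV]
  proof
    fix z
    obtain r L where r: "r > 0" "L-lipschitz_on (cball z r) F" using lip by blast
    from lipschitz_on_continuous_on[OF r(2)] have "continuous_on (ball z r) F"
      by (rule continuous_on_subset) auto
    with r(1) show "isCont F z" by (simp add: continuous_on_eq_continuous_at)
  qed
  have V_cont: "continuous_on UNIV V"
    using has_derivative_continuous[OF V] by (auto simp: continuous_on_eq_continuous_at)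
  have decrease: "V (y t) \<le> exp (- c * t) * V (y 0)"
    if "initial_interval I" "caratheodory_solution F I y" "t \<in> I" for I t and y
    using that by (intro lyapunov_exponential_decay[OF F _ _ _ V decay]) (auto simp: initial_interval_def)
  have bounded_V: "V (y t) \<le> V (y 0)"
    if "initial_interval I" "caratheodory_solution F I y" "t \<in> I" for I t and y
  proof -
    have "0 \<le> t" using that(1,3) by (auto simp: initial_interval_def)
    then have "exp (- c * t) * V (y 0) \<le> 1 * V (y 0)"
      using c V_nonneg by (intro mult_right_mono) auto
    with decrease[OF that] show ?thesis by simp
  qed
  show ?thesis
    unfolding globally_asymptotically_stable_def
  proof (intro conjI allI impI)
    fix \<epsilon> :: real assume "0 < \<epsilon>"
    then obtain w where w: "0 < w" "\<And>z. V z \<le> w \<Longrightarrow> norm z \<le> \<epsilon>"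
      using small by blast
    have "isCont V 0" using V_cont by (simp add: continuous_on_eq_continuous_at)
    then obtain d where d: "0 < d" "\<And>z. norm z < d \<Longrightarrow> \<bar>V z\<bar> < w"
      using w(1) V0 unfolding continuous_at_eps_delta by (auto simp: dist_norm)
    show "\<exists>\<delta>>0. \<forall>E x q. closed_loop_solution f (static_feedback \<phi>) E x q \<and> norm (x 0 0) \<le> \<delta> \<longrightarrow>
            (\<forall>(t, j)\<in>E. norm (x t j) \<le> \<epsilon>)"
    proof (intro exI[of _ "d / 2"] conjI allI impI)
      show "0 < d / 2" using d(1) by simp
      fix E x q
      assume H: "closed_loop_solution f (static_feedback \<phi>) E x q \<and> norm (x 0 0) \<le> d / 2"
      from H[THEN conjunct1] obtain I where I: "initial_interval I" "E = I \<times> {0}"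
        and sol: "caratheodory_solution F I (\<lambda>t. x t 0)"
        unfolding F_def by (rule closed_loop_solution_static_feedbackE)
      have "\<bar>V (x 0 0)\<bar> < w" using H d(1) by (intro d(2)) auto
      then have "norm (x t 0) \<le> \<epsilon>" if "t \<in> I" for t
        using bounded_V[OF I(1) sol that] by (intro w(2)) auto
      then show "\<forall>(t, j)\<in>E. norm (x t j) \<le> \<epsilon>" using I(2) by auto
    qed
  next
    fix E x q
    assume max: "maximal_solution f (static_feedback \<phi>) E x q"
    have cl_sol: "closed_loop_solution f (static_feedback \<phi>) E x q"
      using max by (simp add: maximal_solution_def)
    then obtain I where I: "initial_interval I" "E = I \<times> {0}" and q: "\<forall>t\<in>I. q t 0 = 0"
      and sol: "caratheodory_solution F I (\<lambda>t. x t 0)"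
      unfolding F_def by (rule closed_loop_solution_static_feedbackE)
    have no_extension: False
      if "initial_interval I'" "I \<subset> I'" "caratheodory_solution F I' y" "\<And>t. t \<in> I \<Longrightarrow> y t = x t 0" for I' y
    proof -
      have "closed_loop_solution f (static_feedback \<phi>) (I' \<times> {0}) (\<lambda>t j. y t) (\<lambda>t j. 0)"
        using that(1,3) unfolding F_def by (rule closed_loop_solution_static_feedbackI)
      moreover have "E \<subset> I' \<times> {0}" using that(2) I(2) by auto
      moreover have "\<forall>(t, j)\<in>E. y t = x t j \<and> 0 = q t j" using that(4) q I(2) by auto
      ultimately show False
        using max unfolding maximal_solution_def by blast
    qed
    have I_eq: "I = {0..}"
    proof (rule ccontr)
      assume "I \<noteq> {0..}"
      with I(1) consider b where "0 \<le> b" "I = {0..b}" | T where "0 < T" "I = {0..<T}"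
        unfolding initial_interval_def by blast
      then show False
      proof cases
        case 1
        obtain r L where r: "r > 0" "L-lipschitz_on (cball (x b 0) r) F" using lip by blast
        obtain h y where y: "0 < h" "caratheodory_solution F {0..b + h} y"
          "\<And>t. t \<in> {0..b} \<Longrightarrow> y t = x t 0"
          using caratheodory_solution_extend_beyond[OF F r sol[unfolded 1(2)] 1(1)] by blast
        show False
        proof (rule no_extension[OF _ _ y(2)])
          show "initial_interval {0..b + h}" using 1 y(1) by (auto simp: initial_interval_def)
          show "I \<subset> {0..b + h}" using 1 y(1) by auto
        qed (use y(3) 1(2) in auto)
      next
        case 2
        have "compact {z. V z \<le> V (x 0 0)}"
          using bdd V_cont by (simp add: compact_eq_bounded_closed closed_Collect_le)
        then obtain y where y: "caratheodory_solution F {0..T} y"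
          "\<And>t. t \<in> {0..<T} \<Longrightarrow> y t = x t 0"
          using caratheodory_solution_extend_to_closed[OF F sol[unfolded 2(2)] _ _ 2(1)]
            bounded_V[OF I(1) sol] 2(2) by (metis (mono_tags, lifting) mem_Collect_eq)
        show False
        proof (rule no_extension[OF _ _ y(1)])
          show "initial_interval {0..T}" using 2 by (auto simp: initial_interval_def)
          show "I \<subset> {0..T}" using 2 by auto
        qed (use y(2) 2(2) in auto)
      qed
    qed
    show "\<not> bounded ((\<lambda>(t, j). (t, real j)) ` E)"
    proof
      assume "bounded ((\<lambda>(t, j). (t, real j)) ` E)"
      then have "bounded (fst ` (\<lambda>(t, j). (t, real j)) ` E)"
        by (rule bounded_fst)
      moreover have "fst ` (\<lambda>(t, j). (t, real j)) ` E = {0..}"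
        unfolding I(2) I_eq by force
      ultimately have "bounded {0::real..}" by simp
      then obtain B where "\<forall>t\<in>{0::real..}. norm t \<le> B"
        unfolding bounded_iff by blast
      then have "norm (\<bar>B\<bar> + 1) \<le> B" by (rule bspec) simp
      then show False by simp
    qed
    fix \<epsilon> :: real assume "0 < \<epsilon>"
    then obtain w where w: "0 < w" "\<And>z. V z \<le> w \<Longrightarrow> norm z \<le> \<epsilon>"
      using small by blast
    have "((\<lambda>t. exp (- c * t) * V (x 0 0)) \<longlongrightarrow> 0 * V (x 0 0)) at_top"
      using c by (intro tendsto_intros filterlim_compose[OF exp_at_bot]
          filterlim_tendsto_neg_mult_at_bot[OF tendsto_const _ filterlim_ident]) auto
    then have "eventually (\<lambda>t. exp (- c * t) * V (x 0 0) < w) at_top"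
      using w(1) by (auto dest: order_tendstoD(2))
    then obtain N where N: "\<And>t. N \<le> t \<Longrightarrow> exp (- c * t) * V (x 0 0) < w"
      by (auto simp: eventually_at_top_linorder)
    show "\<exists>N. \<forall>(t, j)\<in>E. N \<le> t + real j \<longrightarrow> norm (x t j) \<le> \<epsilon>"
    proof (intro exI[of _ N] ballI, clarify)
      fix t j assume "(t, j) \<in> E" "N \<le> t + real j"
      then have t: "t \<in> I" "j = 0" "N \<le> t" using I(2) by auto
      show "norm (x t j) \<le> \<epsilon>"
        using decrease[OF I(1) sol t(1)] N[OF t(3)] t(2) by (intro w(2)) simp
    qed
  qed
qed

section \<open>The decay estimate\<close>

text \<open>
  The decay estimate, with \<open>s\<close> in place of the sine. Only two facts about the sine enter:
  \<open>\<bar>sin u\<bar> \<le> 1\<close> and \<open>\<bar>sin u\<bar> \<le> \<bar>u\<bar>\<close>. For \<open>\<bar>x\<bar> \<le> 1\<close> the gain \<open>4 + x\<^sup>2\<close> is at most \<open>5\<close>, so \<open>\<bar>s\<bar> \<le> 5 * \<bar>z\<bar>\<close>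
  and every term with \<open>s\<close> is at most \<open>0.7 * \<bar>x * z\<bar>\<close> or \<open>0.7 * z\<^sup>2\<close>. For \<open>\<bar>x\<bar> > 1\<close> one has
  \<open>\<bar>1 + x\<bar> \<le> 2 * \<bar>x\<bar>\<close>, so with \<open>\<bar>s\<bar> \<le> 1\<close> the term \<open>\<theta> * x * (1 + x) * s\<close> is at most \<open>2 * \<theta> * x\<^sup>2\<close>, while the
  part \<open>x\<^sup>2 * z\<^sup>2\<close> of the dissipation, due to the growing gain, absorbs the mixed terms.
\<close>

lemma lyapunov_form_negative:
  fixes \<theta> x z s :: real
  assumes \<theta>: "0 \<le> \<theta>" "\<theta> \<le> 3/50" and s: "\<bar>s\<bar> \<le> 1" "\<bar>s\<bar> \<le> (4 + x\<^sup>2) * \<bar>z\<bar>"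
  shows "x * (z - x + \<theta> * (1 + x) * s) +
         z / 2 * (- (4 + x\<^sup>2) * z + (2 + 2 * \<theta> * x) * (z - x + \<theta> * (1 + x) * s))
           \<le> - (x\<^sup>2 / 2 + z\<^sup>2 / 4) / 2"
    (is "?lhs \<le> _")
proof -
  define X Z where "X = \<bar>x\<bar>" and "Z = \<bar>z\<bar>"
  have XZ: "0 \<le> X" "0 \<le> Z" "x\<^sup>2 = X\<^sup>2" "z\<^sup>2 = Z\<^sup>2" by (auto simp: X_def Z_def)
  have T1: "- (\<theta> * (x\<^sup>2 * z)) \<le> (3/50) * (X\<^sup>2 * Z)"
  proof -
    have "- (\<theta> * (x\<^sup>2 * z)) \<le> \<bar>\<theta> * (x\<^sup>2 * z)\<bar>" by simp
    also have "\<dots> = \<theta> * (X\<^sup>2 * Z)" using \<theta> by (simp add: abs_mult X_def Z_def)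
    also have "\<dots> \<le> (3/50) * (X\<^sup>2 * Z)" using \<theta> XZ by (intro mult_right_mono) auto
    finally show ?thesis .
  qed
  have \<theta>X: "\<theta> * X \<le> (3/50) * X" using \<theta> XZ by (intro mult_right_mono) auto
  have a: "\<bar>\<theta> * x\<bar> = \<theta> * X" using \<theta> by (simp add: abs_mult X_def)
  have T2: "(1 + \<theta> * x) * z\<^sup>2 \<le> (1 + (3/50) * X) * Z\<^sup>2"
    unfolding XZ(4) using \<theta>X a by (intro mult_right_mono) auto
  have T3: "\<bar>1 + \<theta> * x\<bar> \<le> 1 + (3/50) * X" using \<theta>X a by linarith
  have "?lhs = - x\<^sup>2 - \<theta> * (x\<^sup>2 * z) + \<theta> * (x * ((1 + x) * s)) - (4 + x\<^sup>2) / 2 * z\<^sup>2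
      + (1 + \<theta> * x) * z\<^sup>2 + \<theta> * ((1 + \<theta> * x) * (z * ((1 + x) * s)))"
    by (simp add: algebra_simps power2_eq_square)
  also have "\<dots> \<le> - X\<^sup>2 + (3/50) * (X\<^sup>2 * Z) + (3/50) * (X * \<bar>(1 + x) * s\<bar>) - (4 + X\<^sup>2) / 2 * Z\<^sup>2
      + (1 + (3/50) * X) * Z\<^sup>2 + (3/50) * ((1 + (3/50) * X) * (Z * \<bar>(1 + x) * s\<bar>))"
  proof -
    have "\<theta> * (x * ((1 + x) * s)) \<le> \<bar>\<theta> * (x * ((1 + x) * s))\<bar>" by simp
    also have "\<dots> = \<theta> * (X * \<bar>(1 + x) * s\<bar>)" using \<theta> by (simp add: abs_mult X_def)
    also have "\<dots> \<le> (3/50) * (X * \<bar>(1 + x) * s\<bar>)" using \<theta> XZ by (intro mult_right_mono) auto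
    finally have T4: "\<theta> * (x * ((1 + x) * s)) \<le> (3/50) * (X * \<bar>(1 + x) * s\<bar>)" .
    have "\<theta> * ((1 + \<theta> * x) * (z * ((1 + x) * s))) \<le> \<bar>\<theta> * ((1 + \<theta> * x) * (z * ((1 + x) * s)))\<bar>" by simp
    also have "\<dots> = \<theta> * (\<bar>1 + \<theta> * x\<bar> * (Z * \<bar>(1 + x) * s\<bar>))"
      using \<theta> by (simp add: abs_mult Z_def)
    also have "\<dots> \<le> (3/50) * ((1 + (3/50) * X) * (Z * \<bar>(1 + x) * s\<bar>))"
      using \<theta> XZ T3 by (intro mult_mono) auto
    finally show ?thesis using T1 T2 T4 XZ by simp
  qed
  also have "\<dots> \<le> - X\<^sup>2 / 4 - Z\<^sup>2 / 8"
  proof (cases "X \<le> 1")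
    case True
    have X2: "X\<^sup>2 \<le> X" using True XZ by (simp add: power2_eq_square mult_left_le)
    have sb: "\<bar>(1 + x) * s\<bar> \<le> 10 * Z"
    proof -
      have "\<bar>1 + x\<bar> \<le> 2" using True by (simp add: X_def)
      moreover have "\<bar>s\<bar> \<le> 5 * Z"
        using s(2) X2 True XZ mult_right_mono[of "4 + X\<^sup>2" 5 Z] by (simp add: Z_def)
      ultimately have "\<bar>1 + x\<bar> * \<bar>s\<bar> \<le> 2 * (5 * Z)" by (intro mult_mono) auto
      then show ?thesis by (simp add: abs_mult)
    qed
    have b1: "X\<^sup>2 * Z \<le> X * Z" using X2 XZ by (intro mult_right_mono) auto
    have "X * \<bar>(1 + x) * s\<bar> \<le> X * (10 * Z)" using sb XZ by (intro mult_left_mono) auto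
    then have b2: "X * \<bar>(1 + x) * s\<bar> \<le> 10 * (X * Z)" by simp
    have "(1 + (3/50) * X) * (Z * \<bar>(1 + x) * s\<bar>) \<le> (53/50) * (Z * (10 * Z))"
      using sb XZ True by (intro mult_mono) auto
    then have b3: "(1 + (3/50) * X) * (Z * \<bar>(1 + x) * s\<bar>) \<le> (53/5) * Z\<^sup>2"
      by (simp add: power2_eq_square)
    have b4: "(1 + (3/50) * X) * Z\<^sup>2 \<le> (53/50) * Z\<^sup>2" using True by (intro mult_right_mono) auto
    have b5: "2 * Z\<^sup>2 \<le> (4 + X\<^sup>2) / 2 * Z\<^sup>2" by (intro mult_right_mono) auto
    \<comment> \<open>The discriminant of the remaining form in \<open>X\<close> and \<open>Z\<close> is slightly negative; this square
      witnesses it.\<close>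
    have "0 \<le> (X - (11/25) * Z)\<^sup>2" by simp
    also have "\<dots> = X\<^sup>2 - (22/25) * (X * Z) + (121/625) * Z\<^sup>2"
      by (simp add: power2_eq_square algebra_simps)
    finally have b6: "(22/25) * (X * Z) \<le> X\<^sup>2 + (121/625) * Z\<^sup>2" by simp
    have "0 \<le> Z\<^sup>2" by simp
    with b1 b2 b3 b4 b5 b6 show ?thesis by linarith
  next
    case False
    have X1: "1 \<le> X" "X \<le> X\<^sup>2" using False by (auto simp: power2_eq_square)
    have sb: "\<bar>(1 + x) * s\<bar> \<le> 2 * X"
    proof -
      have "\<bar>1 + x\<bar> \<le> 2 * X" using X1 by (simp add: X_def)
      then have "\<bar>1 + x\<bar> * \<bar>s\<bar> \<le> 2 * X * 1" using s(1) XZ by (intro mult_mono) auto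
      then show ?thesis by (simp add: abs_mult)
    qed
    have "X * \<bar>(1 + x) * s\<bar> \<le> X * (2 * X)" using sb XZ by (intro mult_left_mono) auto
    then have b1: "X * \<bar>(1 + x) * s\<bar> \<le> 2 * X\<^sup>2" by (simp add: power2_eq_square)
    have "(1 + (3/50) * X) * (Z * \<bar>(1 + x) * s\<bar>) \<le> (1 + (3/50) * X) * (Z * (2 * X))"
      using sb XZ by (intro mult_left_mono) auto
    then have b2: "(1 + (3/50) * X) * (Z * \<bar>(1 + x) * s\<bar>) \<le> 2 * (X * Z) + 3/25 * (X\<^sup>2 * Z)"
      by (simp add: power2_eq_square algebra_simps)
    have "X * Z\<^sup>2 \<le> X\<^sup>2 * Z\<^sup>2" using X1 by (intro mult_right_mono) auto
    then have b3: "(1 + (3/50) * X) * Z\<^sup>2 \<le> Z\<^sup>2 + 3/50 * (X\<^sup>2 * Z\<^sup>2)"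
      by (simp add: algebra_simps)
    have b4: "(4 + X\<^sup>2) / 2 * Z\<^sup>2 = 2 * Z\<^sup>2 + (X\<^sup>2 * Z\<^sup>2) / 2" by (simp add: algebra_simps)
    have "0 \<le> (X - X * Z)\<^sup>2" by simp
    also have "\<dots> = X\<^sup>2 - 2 * (X\<^sup>2 * Z) + X\<^sup>2 * Z\<^sup>2" by (simp add: power2_eq_square algebra_simps)
    finally have b5: "2 * (X\<^sup>2 * Z) \<le> X\<^sup>2 + X\<^sup>2 * Z\<^sup>2" by simp
    have "0 \<le> (X - Z)\<^sup>2" by simp
    also have "\<dots> = X\<^sup>2 - 2 * (X * Z) + Z\<^sup>2" by (simp add: power2_eq_square algebra_simps)
    finally have b6: "2 * (X * Z) \<le> X\<^sup>2 + Z\<^sup>2" by simp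
    have b7: "0 \<le> X\<^sup>2" "0 \<le> Z\<^sup>2" "0 \<le> X\<^sup>2 * Z\<^sup>2" by simp_all
    from b1 b2 b3 b4 b5 b6 b7 show ?thesis by linarith
  qed
  finally show ?thesis using XZ by simp
qed

section \<open>The stabilizing feedback\<close>

text \<open>
  The deviation of \<open>x2\<close> from the virtual control \<open>- 2 * x1 - \<theta> * x1\<^sup>2\<close>, for which
  \<open>x1 + x2 + \<theta> * x1\<^sup>2 = - x1\<close>.
\<close>

definition backstepping_error :: "real \<Rightarrow> real \<times> real \<Rightarrow> real" where
  "backstepping_error \<theta> p = snd p + 2 * fst p + \<theta> * (fst p)\<^sup>2"

text \<open>
  The factor \<open>4\<close> beats the destabilizing terms near the origin; the growth with \<open>x1\<close> beats the
  quadratic nonlinearity far away.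
\<close>

definition stabilizing_law :: "real \<Rightarrow> real \<times> real \<Rightarrow> real" where
  "stabilizing_law \<theta> p = - (4 + (fst p)\<^sup>2) * backstepping_error \<theta> p"

text \<open>
  The weight \<open>1 / 4\<close> of the squared error, against \<open>1 / 2\<close>, makes the terms in \<open>x1 * z\<close> of the linear
  part cancel.
\<close>

definition lyapunov :: "real \<Rightarrow> real \<times> real \<Rightarrow> real" where
  "lyapunov \<theta> p = (fst p)\<^sup>2 / 2 + (backstepping_error \<theta> p)\<^sup>2 / 4"

lemma lyapunov_has_derivative:
  "(lyapunov \<theta> has_derivative
     (\<lambda>h. fst p * fst h + backstepping_error \<theta> p / 2 * (snd h + (2 + 2 * \<theta> * fst p) * fst h))) (at p)"
  unfolding lyapunov_def backstepping_error_def
  by (auto intro!: derivative_eq_intros simp: fun_eq_iff field_simps)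

text \<open>
  Products preserve the Lipschitz property only for bounded factors; compactness provides the
  bounds.
\<close>

lemma lipschitz_on_mult_compact:
  fixes f g :: "'a::metric_space \<Rightarrow> real"
  assumes B: "compact B" and "\<exists>L. L-lipschitz_on B f" and "\<exists>L. L-lipschitz_on B g"
  shows "\<exists>L. L-lipschitz_on B (\<lambda>z. f z * g z)"
proof -
  obtain K L where f: "K-lipschitz_on B f" and g: "L-lipschitz_on B g"
    using assms by blast
  have bdd: "\<exists>M\<ge>0. \<forall>z\<in>B. \<bar>h z\<bar> \<le> M" if "C-lipschitz_on B h" for h :: "'a \<Rightarrow> real" and C
  proof -
    have "bounded (h ` B)"
      by (intro compact_imp_bounded compact_continuous_image lipschitz_on_continuous_on[OF that] B)
    then obtain M where "0 < M" "\<forall>v\<in>h ` B. norm v \<le> M" unfolding bounded_pos by blast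
    then show ?thesis by (intro exI[of _ M]) auto
  qed
  obtain M where M: "0 \<le> M" "\<And>z. z \<in> B \<Longrightarrow> \<bar>f z\<bar> \<le> M" using bdd[OF f] by blast
  obtain N where N: "0 \<le> N" "\<And>z. z \<in> B \<Longrightarrow> \<bar>g z\<bar> \<le> N" using bdd[OF g] by blast
  have "(M * L + K * N)-lipschitz_on B (\<lambda>z. f z * g z)"
  proof (rule lipschitz_onI)
    fix z w assume zw: "z \<in> B" "w \<in> B"
    have "f z * g z - f w * g w = f z * (g z - g w) + (f z - f w) * g w"
      by (simp add: algebra_simps)
    then have "\<bar>f z * g z - f w * g w\<bar> \<le> \<bar>f z\<bar> * \<bar>g z - g w\<bar> + \<bar>f z - f w\<bar> * \<bar>g w\<bar>"
      by (metis abs_mult abs_triangle_ineq)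
    also have "\<dots> \<le> M * (L * dist z w) + (K * dist z w) * N"
      using lipschitz_onD[OF f zw] lipschitz_onD[OF g zw] M N zw lipschitz_on_nonneg[OF f]
      by (intro add_mono mult_mono) (auto simp: dist_real_def)
    finally show "dist (f z * g z) (f w * g w) \<le> (M * L + K * N) * dist z w"
      by (simp add: dist_real_def algebra_simps)
  qed (use M N lipschitz_on_nonneg[OF f] lipschitz_on_nonneg[OF g] in auto)
  then show ?thesis by blast
qed

lemma lipschitz_on_sin_comp:
  assumes "\<exists>L. L-lipschitz_on B f"
  shows "\<exists>L. L-lipschitz_on B (\<lambda>z. sin (f z :: real))"
proof -
  obtain L where "L-lipschitz_on B f" using assms by blast
  moreover have "1-lipschitz_on (f ` B) (sin :: real \<Rightarrow> real)"
  proof (rule lipschitz_onI)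
    fix u v :: real
    have "\<bar>sin u - sin v\<bar> = 2 * \<bar>sin ((u - v) / 2)\<bar> * \<bar>cos ((u + v) / 2)\<bar>"
      by (simp add: sin_diff_sin abs_mult)
    also have "\<dots> \<le> 2 * \<bar>(u - v) / 2\<bar> * 1"
      by (intro mult_mono mult_left_mono abs_sin_x_le_abs_x) auto
    finally show "dist (sin u) (sin v) \<le> 1 * dist u v"
      by (simp add: dist_real_def)
  qed simp
  ultimately show ?thesis
    using lipschitz_on_compose2 by blast
qed

lemma closed_loop_lipschitz_on_compact:
  assumes B: "compact B"
  shows "\<exists>L. L-lipschitz_on B (\<lambda>p. f_h \<theta> p (stabilizing_law \<theta> p))"
proof -
  have const: "\<exists>L. L-lipschitz_on B (\<lambda>p. c)" for c :: real
    by (rule exI, rule lipschitz_on_constant)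
  have fst: "\<exists>L. L-lipschitz_on B fst"
    by (rule exI[of _ 1], rule lipschitz_onI) (simp_all add: dist_fst_le)
  have snd: "\<exists>L. L-lipschitz_on B snd"
    by (rule exI[of _ 1], rule lipschitz_onI) (simp_all add: dist_snd_le)
  have add: "\<exists>L. L-lipschitz_on B (\<lambda>p. g p + h p)"
    if "\<exists>L. L-lipschitz_on B g" "\<exists>L. L-lipschitz_on B h" for g h :: "real \<times> real \<Rightarrow> real"
    using that lipschitz_on_add by blast
  note mult = lipschitz_on_mult_compact[OF B]
  have error: "\<exists>L. L-lipschitz_on B (backstepping_error \<theta>)"
    unfolding backstepping_error_def [abs_def] power2_eq_square
    by (intro add mult const fst snd)
  have law: "\<exists>L. L-lipschitz_on B (stabilizing_law \<theta>)"
  proof -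
    have "stabilizing_law \<theta> = (\<lambda>p. (-1) * (4 + fst p * fst p) * backstepping_error \<theta> p)"
      by (simp add: stabilizing_law_def fun_eq_iff power2_eq_square)
    then show ?thesis
      by (simp only:) (intro add mult const fst error)
  qed
  have "\<exists>L. L-lipschitz_on B (\<lambda>p. fst p + snd p + \<theta> * (fst p * fst p)
          + \<theta> * (1 + fst p) * sin (stabilizing_law \<theta> p))"
    by (intro add mult const fst snd lipschitz_on_sin_comp law)
  then obtain L M where "L-lipschitz_on B (\<lambda>p. fst p + snd p + \<theta> * (fst p * fst p)
          + \<theta> * (1 + fst p) * sin (stabilizing_law \<theta> p))" "M-lipschitz_on B (stabilizing_law \<theta>)"
    using law by blast
  from lipschitz_on_Pair[OF this] show ?thesis
    by (auto simp: f_h_def case_prod_unfold power2_eq_square)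
qed

lemma lyapunov_decay:
  assumes "0 < \<theta>" and "\<theta> \<le> 3/50"
  shows "fst p * fst (f_h \<theta> p (stabilizing_law \<theta> p)) + backstepping_error \<theta> p / 2 *
           (snd (f_h \<theta> p (stabilizing_law \<theta> p)) + (2 + 2 * \<theta> * fst p) * fst (f_h \<theta> p (stabilizing_law \<theta> p)))
         \<le> - (1 / 2) * lyapunov \<theta> p"
proof -
  define z s where "z = backstepping_error \<theta> p" and "s = sin (stabilizing_law \<theta> p)"
  have law: "stabilizing_law \<theta> p = - (4 + (fst p)\<^sup>2) * z"
    by (simp add: stabilizing_law_def z_def)
  have k: "0 \<le> 4 + (fst p)\<^sup>2" by simp
  have "\<bar>s\<bar> \<le> \<bar>stabilizing_law \<theta> p\<bar>"
    unfolding s_def by (rule abs_sin_x_le_abs_x)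
  also have "\<dots> = (4 + (fst p)\<^sup>2) * \<bar>z\<bar>"
    by (simp only: law mult_minus_left abs_minus_cancel abs_mult abs_of_nonneg[OF k])
  finally have s: "\<bar>s\<bar> \<le> (4 + (fst p)\<^sup>2) * \<bar>z\<bar>" .
  have s1: "\<bar>s\<bar> \<le> 1" by (simp add: s_def)
  have h1: "fst (f_h \<theta> p (stabilizing_law \<theta> p)) = z - fst p + \<theta> * (1 + fst p) * s"
    by (simp add: f_h_def case_prod_unfold z_def s_def backstepping_error_def)
  have h2: "snd (f_h \<theta> p (stabilizing_law \<theta> p)) = - (4 + (fst p)\<^sup>2) * z"
    by (simp add: f_h_def case_prod_unfold law)
  have rhs: "- (1 / 2) * lyapunov \<theta> p = - ((fst p)\<^sup>2 / 2 + z\<^sup>2 / 4) / 2"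
    by (simp add: lyapunov_def z_def field_simps)
  show ?thesis
    unfolding h1 h2 rhs z_def[symmetric]
    using assms by (intro lyapunov_form_negative s1 s) auto
qed

text \<open>
  For \<open>\<delta> \<rightarrow> 0\<close> this shows that small values of the Lyapunov function are taken only near the
  origin, and for arbitrary \<open>\<delta>\<close> that its sublevel sets are bounded.
\<close>

lemma lyapunov_coercive:
  assumes \<theta>: "0 < \<theta>" "\<theta> \<le> 3/50" and \<delta>: "0 \<le> \<delta>" and le: "lyapunov \<theta> p \<le> \<delta>\<^sup>2"
  shows "norm p \<le> 7 * \<delta> + \<delta>\<^sup>2"
proof -
  define x y z where "x = fst p" and "y = snd p" and "z = backstepping_error \<theta> p"
  have sum_le: "x\<^sup>2 / 2 + z\<^sup>2 / 4 \<le> \<delta>\<^sup>2"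
    using le by (simp add: lyapunov_def x_def z_def)
  then have x2: "x\<^sup>2 \<le> 2 * \<delta>\<^sup>2" and "z\<^sup>2 \<le> 4 * \<delta>\<^sup>2"
    using zero_le_power2[of x] zero_le_power2[of z] by linarith+
  then have z2: "z\<^sup>2 \<le> (2 * \<delta>)\<^sup>2"
    by (simp add: power_mult_distrib)
  have x: "\<bar>x\<bar> \<le> 3/2 * \<delta>"
  proof (rule power2_le_imp_le)
    have "(3/2 * \<delta>)\<^sup>2 = 9/4 * \<delta>\<^sup>2"
      by (simp add: power_mult_distrib power_divide)
    then show "\<bar>x\<bar>\<^sup>2 \<le> (3/2 * \<delta>)\<^sup>2"
      unfolding power2_abs using x2 zero_le_power2[of \<delta>] by linarith
  qed (use \<delta> in simp)
  have z: "\<bar>z\<bar> \<le> 2 * \<delta>"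
    by (rule power2_le_imp_le) (use z2 \<delta> in auto)
  have "0 \<le> \<theta> * x\<^sup>2" using \<theta> by simp
  moreover have "\<theta> * x\<^sup>2 \<le> 3/50 * (2 * \<delta>\<^sup>2)" using \<theta> x2 by (intro mult_mono) auto
  moreover have "y = z - 2 * x - \<theta> * x\<^sup>2"
    by (simp add: x_def y_def z_def backstepping_error_def)
  ultimately have "\<bar>y\<bar> \<le> 5 * \<delta> + 3/25 * \<delta>\<^sup>2"
    using x z by linarith
  moreover have "norm p \<le> \<bar>x\<bar> + \<bar>y\<bar>"
    using norm_Pair_le[of x y] by (simp add: x_def y_def)
  ultimately show ?thesis
    using x zero_le_power2[of \<delta>] \<delta> by linarith
qed

theorem mainTheorem1:
  fixes \<theta> :: real
  assumes "0 < \<theta>" and "\<theta> \<le> 0.06"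
  shows "\<exists>K :: (real \<times> real, nat) hybrid_feedback.
           is_hybrid_feedback K \<and> globally_asymptotically_stable (f_h \<theta>) K"
proof -
  have \<theta>: "0 < \<theta>" "\<theta> \<le> 3/50" using assms by simp_all
  have "is_hybrid_feedback (static_feedback (stabilizing_law \<theta>))"
    unfolding stabilizing_law_def [abs_def] backstepping_error_def
    by (intro is_hybrid_feedback_static_feedback continuous_intros)
  moreover have "globally_asymptotically_stable (f_h \<theta>) (static_feedback (stabilizing_law \<theta>))"
  proof (rule static_feedback_globally_asymptotically_stable)
    show "\<exists>r>0. \<exists>L. L-lipschitz_on (cball p r) (\<lambda>p. f_h \<theta> p (stabilizing_law \<theta> p))" for p
      using closed_loop_lipschitz_on_compact[OF compact_cball] by (intro exI[of _ 1]) simp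
    show "\<exists>w>0. \<forall>p. lyapunov \<theta> p \<le> w \<longrightarrow> norm p \<le> \<epsilon>" if \<epsilon>: "0 < \<epsilon>" for \<epsilon>
    proof (intro exI[of _ "(min 1 (\<epsilon> / 8))\<^sup>2"] conjI allI impI)
      define \<delta> where "\<delta> = min 1 (\<epsilon> / 8)"
      have \<delta>: "0 < \<delta>" "\<delta> \<le> 1" "8 * \<delta> \<le> \<epsilon>" using \<epsilon> by (auto simp: \<delta>_def)
      then show "0 < (min 1 (\<epsilon> / 8))\<^sup>2" by (simp add: \<delta>_def)
      fix p assume "lyapunov \<theta> p \<le> (min 1 (\<epsilon> / 8))\<^sup>2"
      then have "norm p \<le> 7 * \<delta> + \<delta>\<^sup>2"
        using \<delta> by (intro lyapunov_coercive[OF \<theta>]) (auto simp: \<delta>_def)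
      moreover have "\<delta>\<^sup>2 \<le> \<delta>" using \<delta> by (simp add: power2_eq_square mult_left_le)
      ultimately show "norm p \<le> \<epsilon>" using \<delta>(3) by linarith
    qed
    show "bounded {p. lyapunov \<theta> p \<le> w}" for w
      unfolding bounded_iff
    proof (intro exI ballI)
      fix p assume "p \<in> {p. lyapunov \<theta> p \<le> w}"
      then show "norm p \<le> 7 * sqrt \<bar>w\<bar> + (sqrt \<bar>w\<bar>)\<^sup>2"
        by (intro lyapunov_coercive[OF \<theta>]) auto
    qed
    show "(0::real) < 1 / 2" by simp
  qed (rule lyapunov_has_derivative lyapunov_decay[OF \<theta>] |
       simp add: lyapunov_def backstepping_error_def)+
  ultimately show ?thesis by blast
qed

end
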